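(* Let $\alpha,c,\delta>0$ and, for $\tau>0$, let $\mathcal A^\tau$ be the operator on $\mathbb H_0$ described in the context, $b^\tau=\delta+\tau c^2$ and $\gamma^\tau=\alpha-c^2\tau(b^\tau)^{-1}$. Then for each $\tau>0$: (a) The residual spectrum is empty: $\sigma_r(\mathcal A^\tau)=\emptyset$. (b) The continuous spectrum is given by $$\sigma_c(\mathcal A^\tau)=\begin{cases}\left\{-\dfrac{c^2}{b^\tau}\right\}&\text{if }\gamma^\tau>0,\\[2mm] \emptyset&\text{if }\gamma^\tau=0.\end{cases}$$ (c) The point spectrum is given by $$\sigma_p(\mathcal A^\tau)=\{\lambda\in\mathbb C:\ \tau\lambda^3+\alpha\lambda^2+b^\tau\mu_n\lambda+c^2\mu_n=0,\ n\in\mathbb N\}=\{\lambda_n^{0,\tau},\lambda_n^{1,\tau},\lambda_n^{2,\tau}:\ n\in\mathbb N\}.$$ For a suitable labelling of the three roots for each $n$, the branch $\lambda_n^{0,\tau}$ is eventually real (real for all sufficiently large $n$), while the other two branches are eventually complex (non-real), conjugate to each other, and $$\lim_{n\to\infty}\lambda_n^{0,\tau}=-\frac{c^2}{b^\tau},\qquad \lim_{n\to\infty}\operatorname{Re}(\lambda_n^{1,\tau})=-\frac{\gamma^\tau}{2\tau},\qquad \lim_{n\to\infty}|\operatorname{Im}(\lambda_n^{1,\tau})|=\infty.$$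
   Context: $A$ is a positive self-adjoint operator with compact resolvent on an infinite-dimensional separable Hilbert space $H$ (for instance $H=L^2(\Omega)$ and $A$ the Dirichlet Laplacian $-\Delta$ on a bounded $C^2$ domain $\Omega$). Its spectrum is $\sigma(A)=\sigma_p(A)=\{\mu_n\}_{n\in\mathbb N}\subset(0,\infty)$ with $\mu_n\to\infty$. The space is $\mathbb H_0=\mathcal D(A^{1/2})\times\mathcal D(A^{1/2})\times H$ (complexified). The operator is $$\mathcal A^\tau(u,v,w)=\big(v,\ w,\ -\tau^{-1}A(c^2u+b^\tau v)-\tau^{-1}\alpha w\big)$$ with natural domain $\mathcal D(\mathcal A^\tau)=\{(u,v,w)\in\mathbb H_0:\ w\in\mathcal D(A^{1/2}),\ c^2u+b^\tau v\in\mathcal D(A)\}$. $\sigma_p,\sigma_c,\sigma_r$ denote the point, continuous and residual spectrum. *)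

theory Defs
  imports "HOL-Analysis.Analysis"
begin

text \<open>
  A partially defined operator is given by its domain \<open>D\<close> and a function \<open>T\<close> whose values
  outside \<open>D\<close> are irrelevant.  A real normed space that is not a type is given by a carrier
  \<open>X\<close> and a norm \<open>N\<close>.
\<close>

definition linear_operator :: "'a::real_vector set \<Rightarrow> ('a \<Rightarrow> 'a) \<Rightarrow> bool" where
  "linear_operator D T \<longleftrightarrow> subspace D \<and>
     (\<forall>x\<in>D. \<forall>y\<in>D. T (x + y) = T x + T y) \<and> (\<forall>r. \<forall>x\<in>D. T (r *\<^sub>R x) = r *\<^sub>R T x)"

text \<open>
  The right-hand side of the last equivalence says that \<open>(y, z)\<close> lies in the graph of the
  adjoint, so that the clause is equality of the graphs of \<open>T\<close> and its adjoint, domains included.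
\<close>

definition self_adjoint :: "'a::real_inner set \<Rightarrow> ('a \<Rightarrow> 'a) \<Rightarrow> bool" where
  "self_adjoint D T \<longleftrightarrow> linear_operator D T \<and> closure D = UNIV \<and>
     (\<forall>y z. (y \<in> D \<and> z = T y) \<longleftrightarrow> (\<forall>x\<in>D. inner (T x) y = inner x z))"

text \<open>
  The square root of a positive self-adjoint operator \<open>A\<close>: the (unique) nonnegative
  self-adjoint operator \<open>B\<close>, with domain \<open>V\<close>, such that \<open>B\<^sup>2 = A\<close> as unbounded operators.
\<close>

definition is_sqrt_of :: "'a::real_inner set \<Rightarrow> ('a \<Rightarrow> 'a) \<Rightarrow> 'a set \<Rightarrow> ('a \<Rightarrow> 'a) \<Rightarrow> bool" where
  "is_sqrt_of V B D A \<longleftrightarrow> self_adjoint V B \<and> (\<forall>x\<in>V. 0 \<le> inner (B x) x) \<and>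
     D = {x \<in> V. B x \<in> V} \<and> (\<forall>x\<in>D. A x = B (B x))"

text \<open>
  Complexification: the pair \<open>(x, y)\<close> stands for \<open>x + \<i>y\<close>, the complexification of
  \<open>(X, N)\<close> is \<open>X \<times> X\<close> with norm \<open>cnorm N\<close>, and the complexification of an operator
  \<open>T\<close> with domain \<open>D\<close> is \<open>map_prod T T\<close> with domain \<open>D \<times> D\<close>.
\<close>

definition cscale :: "complex \<Rightarrow> 'v::real_vector \<times> 'v \<Rightarrow> 'v \<times> 'v" where
  "cscale l z = (Re l *\<^sub>R fst z - Im l *\<^sub>R snd z, Im l *\<^sub>R fst z + Re l *\<^sub>R snd z)"

definition cnorm :: "('v \<Rightarrow> real) \<Rightarrow> 'v \<times> 'v \<Rightarrow> real" where
  "cnorm N z = sqrt ((N (fst z))\<^sup>2 + (N (snd z))\<^sup>2)"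

definition shifted :: "('v::real_vector \<Rightarrow> 'v) \<Rightarrow> complex \<Rightarrow> 'v \<times> 'v \<Rightarrow> 'v \<times> 'v" where
  "shifted T l z = cscale l z - map_prod T T z"

text \<open>
  Spectral notions for a linear operator in a real normed space are those of its complexification.
\<close>

definition resolvent_set ::
    "'v::real_vector set \<Rightarrow> ('v \<Rightarrow> real) \<Rightarrow> 'v set \<Rightarrow> ('v \<Rightarrow> 'v) \<Rightarrow> complex set" where
  "resolvent_set X N D T = {l. bij_betw (shifted T l) (D \<times> D) (X \<times> X) \<and>
     (\<exists>C. \<forall>z \<in> D \<times> D. cnorm N z \<le> C * cnorm N (shifted T l z))}"

definition spectrum ::
    "'v::real_vector set \<Rightarrow> ('v \<Rightarrow> real) \<Rightarrow> 'v set \<Rightarrow> ('v \<Rightarrow> 'v) \<Rightarrow> complex set" where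
  "spectrum X N D T = - resolvent_set X N D T"

definition point_spectrum :: "'v::real_vector set \<Rightarrow> ('v \<Rightarrow> 'v) \<Rightarrow> complex set" where
  "point_spectrum D T = {l. \<exists>z \<in> D \<times> D. z \<noteq> 0 \<and> map_prod T T z = cscale l z}"

definition dense_range ::
    "'v::real_vector set \<Rightarrow> ('v \<Rightarrow> real) \<Rightarrow> 'v set \<Rightarrow> ('v \<Rightarrow> 'v) \<Rightarrow> complex \<Rightarrow> bool" where
  "dense_range X N D T l \<longleftrightarrow>
     (\<forall>y \<in> X \<times> X. \<forall>e>0. \<exists>z \<in> D \<times> D. cnorm N (shifted T l z - y) < e)"

definition continuous_spectrum ::
    "'v::real_vector set \<Rightarrow> ('v \<Rightarrow> real) \<Rightarrow> 'v set \<Rightarrow> ('v \<Rightarrow> 'v) \<Rightarrow> complex set" where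
  "continuous_spectrum X N D T =
     {l \<in> spectrum X N D T. l \<notin> point_spectrum D T \<and> dense_range X N D T l}"

definition residual_spectrum ::
    "'v::real_vector set \<Rightarrow> ('v \<Rightarrow> real) \<Rightarrow> 'v set \<Rightarrow> ('v \<Rightarrow> 'v) \<Rightarrow> complex set" where
  "residual_spectrum X N D T =
     {l \<in> spectrum X N D T. l \<notin> point_spectrum D T \<and> \<not> dense_range X N D T l}"

text \<open>
  The set whose closure is taken is the image of the closed unit ball under the resolvent at \<open>l\<close>.
\<close>

definition compact_resolvent :: "'a::real_inner set \<Rightarrow> ('a \<Rightarrow> 'a) \<Rightarrow> bool" where
  "compact_resolvent D T \<longleftrightarrow>
     (\<exists>l \<in> resolvent_set UNIV norm D T. compact (closure {z \<in> D \<times> D. norm (shifted T l z) \<le> 1}))"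

text \<open>
  In the following, \<open>A\<close> has domain \<open>D\<close>, and \<open>B\<close>, with domain \<open>V\<close>, is its square root.
  The norm used on \<open>V\<close> is \<open>u \<mapsto> norm (B u)\<close>; it is equivalent to the graph norm of \<open>B\<close>
  when the spectrum of \<open>A\<close> is bounded away from 0.
\<close>

definition H0_space :: "'a set \<Rightarrow> ('a \<times> 'a \<times> 'a) set" where
  "H0_space V = V \<times> V \<times> UNIV"

definition H0_norm :: "('a::real_inner \<Rightarrow> 'a) \<Rightarrow> 'a \<times> 'a \<times> 'a \<Rightarrow> real" where
  "H0_norm B = (\<lambda>(u, v, w). sqrt ((norm (B u))\<^sup>2 + (norm (B v))\<^sup>2 + (norm w)\<^sup>2))"

definition b_coeff :: "real \<Rightarrow> real \<Rightarrow> real \<Rightarrow> real" where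
  "b_coeff c \<delta> \<tau> = \<delta> + \<tau> * c\<^sup>2"

definition gamma_coeff :: "real \<Rightarrow> real \<Rightarrow> real \<Rightarrow> real \<Rightarrow> real" where
  "gamma_coeff \<alpha> c \<delta> \<tau> = \<alpha> - c\<^sup>2 * \<tau> * inverse (b_coeff c \<delta> \<tau>)"

definition mgt_domain ::
    "'a::real_inner set \<Rightarrow> 'a set \<Rightarrow> real \<Rightarrow> real \<Rightarrow> real \<Rightarrow> ('a \<times> 'a \<times> 'a) set" where
  "mgt_domain D V c \<delta> \<tau> =
     {(u, v, w) \<in> H0_space V. w \<in> V \<and> c\<^sup>2 *\<^sub>R u + b_coeff c \<delta> \<tau> *\<^sub>R v \<in> D}"

definition mgt_op ::
    "('a::real_inner \<Rightarrow> 'a) \<Rightarrow> real \<Rightarrow> real \<Rightarrow> real \<Rightarrow> real \<Rightarrow> 'a \<times> 'a \<times> 'a \<Rightarrow> 'a \<times> 'a \<times> 'a" where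
  "mgt_op A \<alpha> c \<delta> \<tau> = (\<lambda>(u, v, w).
     (v, w, - (inverse \<tau> *\<^sub>R A (c\<^sup>2 *\<^sub>R u + b_coeff c \<delta> \<tau> *\<^sub>R v)) - (inverse \<tau> * \<alpha>) *\<^sub>R w))"

definition mgt_cubic :: "real \<Rightarrow> real \<Rightarrow> real \<Rightarrow> real \<Rightarrow> real \<Rightarrow> complex \<Rightarrow> complex" where
  "mgt_cubic \<alpha> c \<delta> \<tau> m l =
     of_real \<tau> * l ^ 3 + of_real \<alpha> * l\<^sup>2 + of_real (b_coeff c \<delta> \<tau> * m) * l + of_real (c\<^sup>2 * m)"

end

theory Submission
  imports Defs "HOL-Real_Asymp.Real_Asymp"
begin

text \<open>
  Solving \<open>(\<lambda> - \<A>) (u, v, w) = (f, g, h)\<close> for \<open>v\<close> and \<open>w\<close> leaves an equation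
  \<open>(- \<kappa> - A) p = F\<close> for \<open>p = c\<^sup>2 u + b v = (c\<^sup>2 + b \<lambda>) u - b f\<close>, where
  \<open>\<kappa> = (\<tau> \<lambda> + \<alpha>) \<lambda>\<^sup>2 / (c\<^sup>2 + b \<lambda>)\<close>, and \<open>\<kappa> = - \<mu>\<^sub>n\<close> is the cubic equation.  The spectrum of \<open>A\<close> consists
  of eigenvalues because its resolvent is compact, so every \<open>\<lambda> \<noteq> - c\<^sup>2/b\<close> is either an eigenvalue or in the
  resolvent set.  At \<open>\<lambda> = - c\<^sup>2/b\<close> the cubic takes the value \<open>\<gamma> \<lambda>\<^sup>2\<close>.  If \<open>\<gamma> \<noteq> 0\<close>, this point is the
  limit of the real eigenvalues, hence in the spectrum, and the equation, which forces \<open>p = - b f\<close>, is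
  solvable for a dense set of right-hand sides.
\<close>

subsection \<open>Complexification\<close>

lemma vector_space_cscale: "vector_space (cscale :: complex \<Rightarrow> 'v::real_vector \<times> 'v \<Rightarrow> 'v \<times> 'v)"
  by unfold_locales (auto simp: cscale_def prod_eq_iff algebra_simps)

text \<open>The type of pairs carries only a real structure. With this interpretation, identities
  between complex multiples are checked by the vector space laws.\<close>

interpretation cscale: vector_space "cscale :: complex \<Rightarrow> 'v::real_vector \<times> 'v \<Rightarrow> 'v \<times> 'v"
  by (rule vector_space_cscale)

lemma cscale_of_real [simp]: "cscale (of_real r) z = r *\<^sub>R z"
  by (simp add: cscale_def prod_eq_iff)

text \<open>The real inner product of pairs is the real part of the Hermitian one, so the adjoint of
  multiplication by \<open>l\<close> is multiplication by \<open>cnj l\<close>.\<close>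

lemma inner_cscale_left: "inner (cscale l x) y = inner x (cscale (cnj l) y)"
  by (simp add: cscale_def inner_prod_def algebra_simps)

lemma norm_cscale: "norm (cscale l z) = cmod l * norm (z :: 'v::real_inner \<times> 'v)"
proof -
  have "inner (cscale l z) (cscale l z) = inner z (cscale (cnj l * l) z)"
    by (simp add: inner_cscale_left)
  also have "cnj l * l = of_real ((cmod l)\<^sup>2)"
    by (metis complex_norm_square mult.commute of_real_power)
  finally have "(norm (cscale l z))\<^sup>2 = (cmod l * norm z)\<^sup>2"
    by (simp add: power2_norm_eq_inner power_mult_distrib del: of_real_power)
  then show ?thesis
    by (simp add: power2_eq_iff_nonneg)
qed

lemma bounded_linear_cscale:
  "bounded_linear (cscale l :: 'v::real_inner \<times> 'v \<Rightarrow> 'v \<times> 'v)"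
  by (rule bounded_linear_intro [where K = "cmod l"])
    (auto simp: cscale.scale_right_distrib norm_cscale, simp add: cscale_def algebra_simps)

lemmas tendsto_cscale [tendsto_intros] = bounded_linear.tendsto [OF bounded_linear_cscale]

lemma cnorm_norm [simp]: "cnorm norm = norm"
  by (auto simp: cnorm_def norm_prod_def)

lemma cscale_mem_Times: "subspace X \<Longrightarrow> z \<in> X \<times> X \<Longrightarrow> cscale l z \<in> X \<times> X"
  by (auto simp: cscale_def mem_Times_iff subspace_add subspace_diff subspace_scale)

subsection \<open>Linear and self-adjoint operators\<close>

context
  fixes D :: "'a::real_vector set" and T
  assumes lin: "linear_operator D T"
begin

lemma linear_operator_subspace: "subspace D"
  using lin by (simp add: linear_operator_def)

lemma linear_operator_add: "x \<in> D \<Longrightarrow> y \<in> D \<Longrightarrow> T (x + y) = T x + T y"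
  using lin by (simp add: linear_operator_def)

lemma linear_operator_scaleR: "x \<in> D \<Longrightarrow> T (r *\<^sub>R x) = r *\<^sub>R T x"
  using lin by (simp add: linear_operator_def)

lemma linear_operator_zero: "T 0 = 0"
  using linear_operator_scaleR [of 0 0] linear_operator_subspace subspace_0 by auto

lemma linear_operator_diff: "x \<in> D \<Longrightarrow> y \<in> D \<Longrightarrow> T (x - y) = T x - T y"
  using linear_operator_add [of "x - y" y] linear_operator_subspace subspace_diff
  by (metis add_diff_cancel_right' diff_add_cancel)

lemma linear_operator_map_prod: "linear_operator (D \<times> D) (map_prod T T)"
  using subspace_Times [OF linear_operator_subspace linear_operator_subspace]
  by (auto simp: linear_operator_def linear_operator_add linear_operator_scaleR)

lemma map_prod_cscale: "z \<in> D \<times> D \<Longrightarrow> map_prod T T (cscale l z) = cscale l (map_prod T T z)"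
  using linear_operator_subspace
  by (auto simp: cscale_def linear_operator_add linear_operator_diff linear_operator_scaleR
      subspace_scale)

lemma linear_operator_shifted: "linear_operator (D \<times> D) (shifted T l)"
  using linear_operator_map_prod unfolding linear_operator_def shifted_def
  by (auto simp: cscale.scale_right_distrib scaleR_diff_right)
     (simp_all add: cscale_def algebra_simps)

end

lemma self_adjoint_linear_operator: "self_adjoint D T \<Longrightarrow> linear_operator D T"
  by (simp add: self_adjoint_def)

lemma self_adjoint_symmetric:
  "self_adjoint D T \<Longrightarrow> x \<in> D \<Longrightarrow> y \<in> D \<Longrightarrow> inner (T x) y = inner x (T y)"
  unfolding self_adjoint_def by blast

lemma self_adjointD:
  assumes "self_adjoint D T" "\<And>x. x \<in> D \<Longrightarrow> inner (T x) y = inner x z"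
  shows "y \<in> D" "T y = z"
proof -
  have "\<forall>y z. (y \<in> D \<and> z = T y) \<longleftrightarrow> (\<forall>x\<in>D. inner (T x) y = inner x z)"
    using assms(1) by (simp add: self_adjoint_def)
  then have "y \<in> D \<and> z = T y"
    using assms(2) by blast
  then show "y \<in> D" "T y = z" by auto
qed

text \<open>Lets the complexified operator be handled as a self-adjoint operator on the real inner
  product space of pairs.\<close>

lemma self_adjoint_map_prod:
  fixes D :: "'a::real_inner set"
  assumes "self_adjoint D T"
  shows "self_adjoint (D \<times> D) (map_prod T T)"
proof -
  note lin = self_adjoint_linear_operator [OF assms]
  have 0: "0 \<in> D" "T 0 = 0"
    using linear_operator_subspace [OF lin] subspace_0 linear_operator_zero [OF lin] by auto
  have "y \<in> D \<times> D \<and> z = map_prod T T y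
    \<longleftrightarrow> (\<forall>x\<in>D \<times> D. inner (map_prod T T x) y = inner x z)" (is "?L \<longleftrightarrow> ?R") for y z
  proof
    assume ?L
    then show ?R
      using self_adjoint_symmetric [OF assms] by (auto simp: inner_prod_def)
  next
    assume R: ?R
    \<comment> \<open>Testing with \<open>(x, 0)\<close> and \<open>(0, x)\<close> separates the
      adjoint condition into its two components.\<close>
    have 1: "inner (T x) (fst y) = inner x (fst z)" if "x \<in> D" for x
      using R [rule_format, of "(x, 0)"] that 0 by (simp add: inner_prod_def)
    have 2: "inner (T x) (snd y) = inner x (snd z)" if "x \<in> D" for x
      using R [rule_format, of "(0, x)"] that 0 by (simp add: inner_prod_def)
    show ?L
      using self_adjointD [OF assms 1] self_adjointD [OF assms 2]
      by (simp add: mem_Times_iff prod_eq_iff)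
  qed
  moreover have "closure (D \<times> D) = UNIV"
    using assms by (simp add: closure_Times self_adjoint_def)
  ultimately show ?thesis
    using linear_operator_map_prod [OF lin] by (simp add: self_adjoint_def)
qed

text \<open>The graph of an adjoint is cut out by equations that are continuous in
  \<open>(y, z)\<close>, so it is closed.\<close>

lemma self_adjoint_closed_graph:
  assumes "self_adjoint D T" "\<And>n. x n \<in> D" "x \<longlonglongrightarrow> a" "(\<lambda>n. T (x n)) \<longlonglongrightarrow> b"
  shows "a \<in> D" "T a = b"
proof -
  have "inner (T y) a = inner y b" if "y \<in> D" for y
  proof (rule LIMSEQ_unique)
    show "(\<lambda>n. inner (T y) (x n)) \<longlonglongrightarrow> inner (T y) a"
      by (intro tendsto_intros assms(3))
    have "(\<lambda>n. inner y (T (x n))) \<longlonglongrightarrow> inner y b"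
      by (intro tendsto_intros assms(4))
    then show "(\<lambda>n. inner (T y) (x n)) \<longlonglongrightarrow> inner y b"
      by (simp only: self_adjoint_symmetric [OF assms(1) that assms(2)])
  qed
  then show "a \<in> D" "T a = b"
    using self_adjointD [OF assms(1), of a b] by auto
qed

text \<open>The projection theorem: a minimizing sequence for the distance from a point
  \<open>y\<close> outside \<open>M\<close> is Cauchy, and the difference of \<open>y\<close> and
  its limit is orthogonal to \<open>M\<close>.\<close>

lemma complete_proper_subspace_orthogonal:
  fixes M :: "'a::real_inner set"
  assumes "subspace M" "complete M" "M \<noteq> UNIV"
  obtains z where "z \<noteq> 0" "\<And>m. m \<in> M \<Longrightarrow> inner m z = 0"
proof -
  obtain y where y: "y \<notin> M" using assms(3) by auto
  define d where "d = infdist y M"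
  have ne: "M \<noteq> {}" using assms(1) subspace_0 by auto
  have d0: "d \<ge> 0" by (simp add: d_def infdist_nonneg)
  have d: "d \<le> norm (y - m)" if "m \<in> M" for m
    using infdist_le [OF that, of y] by (simp add: d_def dist_norm)
  have "\<exists>m\<in>M. norm (y - m) < d + 1 / Suc n" for n
  proof -
    have "infdist y M < d + 1 / Suc n" by (simp add: d_def)
    then show ?thesis
      using cInf_lessD [of "{dist y a |a. a \<in> M}"] ne
      by (auto simp: infdist_notempty dist_norm Setcompr_eq_image)
  qed
  then obtain m where m: "\<And>n. m n \<in> M" "\<And>n. norm (y - m n) < d + 1 / Suc n"
    by metis
  \<comment> \<open>Parallelogram identity for \<open>y - m i\<close> and \<open>y - m j\<close>;
    the midpoint of \<open>m i\<close> and \<open>m j\<close> lies in \<open>M\<close>, so its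
    distance from \<open>y\<close> is at least \<open>d\<close>.\<close>
  have par: "(norm (m i - m j))\<^sup>2 \<le> 2 * (norm (y - m i))\<^sup>2 + 2 * (norm (y - m j))\<^sup>2 - 4 * d\<^sup>2" for i j
  proof -
    have "(1/2) *\<^sub>R (m i + m j) \<in> M"
      by (intro subspace_scale subspace_add assms m)
    then have "d\<^sup>2 \<le> (norm (y - (1/2) *\<^sub>R (m i + m j)))\<^sup>2"
      using d d0 by (intro power_mono) auto
    moreover have "(norm (m i - m j))\<^sup>2 + 4 * (norm (y - (1/2) *\<^sub>R (m i + m j)))\<^sup>2
        = 2 * (norm (y - m i))\<^sup>2 + 2 * (norm (y - m j))\<^sup>2"
      by (simp add: power2_norm_eq_inner inner_diff inner_add algebra_simps inner_commute)
    ultimately show ?thesis by linarith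
  qed
  have lim: "(\<lambda>n. norm (y - m n)) \<longlonglongrightarrow> d"
  proof (rule tendsto_sandwich [where f = "\<lambda>_. d" and h = "\<lambda>n. d + 1 / Suc n"])
    show "(\<lambda>n. d + 1 / Suc n) \<longlonglongrightarrow> d"
      using tendsto_add [OF tendsto_const LIMSEQ_inverse_real_of_nat, of d]
      by (simp add: inverse_eq_divide)
  qed (use d m in \<open>auto intro!: always_eventually less_imp_le\<close>)
  have "Cauchy m"
  proof (rule metric_CauchyI)
    fix e :: real assume e: "e > 0"
    have "(\<lambda>n. (norm (y - m n))\<^sup>2) \<longlonglongrightarrow> d\<^sup>2"
      by (intro tendsto_intros lim)
    then have "\<forall>\<^sub>F n in sequentially. (norm (y - m n))\<^sup>2 < d\<^sup>2 + e\<^sup>2 / 4"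
      using e by (intro order_tendstoD) auto
    then obtain N where N: "\<And>n. n \<ge> N \<Longrightarrow> (norm (y - m n))\<^sup>2 < d\<^sup>2 + e\<^sup>2 / 4"
      by (auto simp: eventually_sequentially)
    have "norm (m i - m j) < e" if "i \<ge> N" "j \<ge> N" for i j
    proof -
      have "(norm (m i - m j))\<^sup>2 < e\<^sup>2"
        using par [of i j] N [OF that(1)] N [OF that(2)] by linarith
      then show ?thesis using e by (simp add: power2_less_imp_less)
    qed
    then show "\<exists>N. \<forall>i\<ge>N. \<forall>j\<ge>N. dist (m i) (m j) < e"
      by (auto simp: dist_norm)
  qed
  then obtain a where a: "a \<in> M" "m \<longlonglongrightarrow> a"
    using assms(2) m(1) unfolding complete_def by blast
  have "(\<lambda>n. norm (y - m n)) \<longlonglongrightarrow> norm (y - a)"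
    by (intro tendsto_intros a)
  then have ya: "norm (y - a) = d"
    using lim LIMSEQ_unique by blast
  have "inner x (y - a) = 0" if x: "x \<in> M" for x
  proof (cases "x = 0")
    case False
    \<comment> \<open>The point \<open>a + t x\<close> with this \<open>t\<close> is the closest to
      \<open>y\<close> on its line; a nonzero inner product would make it closer than
      \<open>a\<close>.\<close>
    define t where "t = inner x (y - a) / inner x x"
    have "a + t *\<^sub>R x \<in> M"
      by (intro subspace_scale subspace_add assms a x)
    then have "(norm (y - a))\<^sup>2 \<le> (norm (y - (a + t *\<^sub>R x)))\<^sup>2"
      using d d0 ya by (intro power_mono) auto
    also have "\<dots> = (norm (y - a))\<^sup>2 - 2 * t * inner x (y - a) + t * (t * inner x x)"
      by (simp add: power2_norm_eq_inner inner_diff inner_add algebra_simps inner_commute)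
    also have "t * inner x x = inner x (y - a)"
      using False by (simp add: t_def)
    finally have "t * inner x (y - a) \<le> 0" by simp
    then have "(inner x (y - a))\<^sup>2 / inner x x \<le> 0"
      by (simp add: t_def power2_eq_square)
    then show ?thesis
      using False by (auto simp: divide_le_0_iff not_le dest: leD simp flip: inner_gt_zero_iff)
  qed simp
  moreover have "y - a \<noteq> 0" using y a by auto
  ultimately show ?thesis using that by blast
qed

subsection \<open>Spectrum of a self-adjoint operator with compact resolvent\<close>

text \<open>\<open>T\<close> is real, so negating the imaginary part of an eigenvector conjugates
  the eigenvalue.\<close>

lemma point_spectrum_cnj:
  assumes "linear_operator D T" "l \<in> point_spectrum D T"
  shows "cnj l \<in> point_spectrum D T"
proof -
  note lin = assms(1)
  obtain x y where z: "(x, y) \<in> D \<times> D" "(x, y) \<noteq> 0" "map_prod T T (x, y) = cscale l (x, y)"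
    using assms(2) by (auto simp: point_spectrum_def)
  have "T (- y) = - T y"
    using linear_operator_scaleR [OF lin, of y "-1"] z by simp
  then have "map_prod T T (x, - y) = cscale (cnj l) (x, - y)"
    using z by (simp add: cscale_def)
  moreover have "(x, - y) \<in> D \<times> D" "(x, - y) \<noteq> 0"
    using z linear_operator_subspace [OF lin] by (auto simp: zero_prod_def subspace_neg)
  ultimately show ?thesis
    unfolding point_spectrum_def by blast
qed

text \<open>Since \<open>r\<close> is real, the real and imaginary parts satisfy the eigenvalue
  equation separately, and one of them is nonzero.\<close>

lemma point_spectrum_eigenvector:
  assumes "linear_operator D T" "of_real r \<in> point_spectrum D T"
  obtains x where "x \<in> D" "x \<noteq> 0" "T x = r *\<^sub>R x"
proof -
  obtain x y where z: "(x, y) \<in> D \<times> D" "(x, y) \<noteq> 0" "map_prod T T (x, y) = cscale (of_real r) (x, y)"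
    using assms(2) by (auto simp: point_spectrum_def)
  then show ?thesis
    using that [of x] that [of y] by (auto simp: zero_prod_def)
qed

text \<open>Without a bound there would be normalized approximate eigenvectors for \<open>l\<close>.
  The compact resolvent gives a convergent subsequence, and the closed graph makes its limit an
  eigenvector.\<close>

lemma compact_resolvent_bounded_below:
  fixes D :: "'a::real_inner set"
  assumes sa: "self_adjoint D T" and "compact_resolvent D T" and l: "l \<notin> point_spectrum D T"
  shows "\<exists>C. \<forall>z\<in>D \<times> D. norm z \<le> C * norm (shifted T l z)"
proof (rule ccontr)
  note lin = self_adjoint_linear_operator [OF sa]
  note linS = linear_operator_shifted [OF lin]
  note sub = linear_operator_subspace [OF linS]
  assume "\<not> ?thesis"
  then have "\<exists>z\<in>D \<times> D. norm z > real (Suc n) * norm (shifted T l z)" for n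
    by (meson not_le)
  then obtain z where z: "\<And>n. z n \<in> D \<times> D" 
    "\<And>n. norm (z n) > real (Suc n) * norm (shifted T l (z n))"
    by metis
  obtain k where k: "compact (closure {z \<in> D \<times> D. norm (shifted T k z) \<le> 1})"
    using assms(2) by (auto simp: compact_resolvent_def)
  \<comment> \<open>With norm \<open>1 / r\<close> instead of 1, an approximate eigenvector
    \<open>y\<close> satisfies \<open>norm (shifted T k y) <= 1 / r + cmod (k - l) / r = 1\<close>,
    which places it in the compact set.\<close>
  define r where "r = cmod (k - l) + 1"
  have r: "r > 0" by (simp add: r_def add_nonneg_pos)
  define y where "y n = (inverse (r * norm (z n))) *\<^sub>R z n" for n
  have nz: "norm (z n) > 0" for n
    using z(2) [of n] by (smt (verit) mult_nonneg_nonneg norm_ge_zero of_nat_0_le_iff)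
  have yD: "y n \<in> D \<times> D" for n
    unfolding y_def by (rule subspace_scale [OF sub z(1)])
  have ny: "norm (y n) = inverse r" for n
    using nz [of n] r by (simp add: y_def)
  have Sy: "norm (shifted T l (y n)) \<le> inverse r / Suc n" for n
  proof -
    have "norm (shifted T l (y n)) = inverse r * (norm (shifted T l (z n)) / norm (z n))"
      using linear_operator_scaleR [OF linS z(1) [of n]] r nz [of n] 
      by (simp add: y_def divide_inverse)
    also have "norm (shifted T l (z n)) / norm (z n) \<le> 1 / Suc n"
      using z(2) [of n] nz [of n] by (simp add: field_simps)
    finally show ?thesis using r by (simp add: field_simps)
  qed
  have "y n \<in> {z \<in> D \<times> D. norm (shifted T k z) \<le> 1}" for n
  proof -
    have "shifted T k (y n) = shifted T l (y n) + cscale (k - l) (y n)"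
      by (simp add: shifted_def cscale.scale_left_diff_distrib)
    then have "norm (shifted T k (y n)) \<le> norm (shifted T l (y n)) + norm (cscale (k - l) (y n))"
      by (simp add: norm_triangle_ineq)
    also have "\<dots> \<le> inverse r / Suc n + cmod (k - l) * inverse r"
      using Sy [of n] by (simp add: norm_cscale ny)
    also have "inverse r / Suc n \<le> inverse r / 1"
      using r by (intro divide_left_mono) auto
    also have "inverse r / 1 + cmod (k - l) * inverse r = 1"
      using r by (simp add: r_def field_simps)
    finally show ?thesis using yD by simp
  qed
  then have "\<forall>n. y n \<in> closure {z \<in> D \<times> D. norm (shifted T k z) \<le> 1}"
    using closure_subset by blast
  then obtain a s where s: "strict_mono s" "(y \<circ> s) \<longlonglongrightarrow> a"
    using k [unfolded compact_def, rule_format, of y] by auto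
  have "(\<lambda>n. shifted T l (y n)) \<longlonglongrightarrow> 0"
  proof (rule Lim_null_comparison)
    show "(\<lambda>n. inverse r / Suc n) \<longlonglongrightarrow> 0"
      using tendsto_mult [OF tendsto_const LIMSEQ_inverse_real_of_nat, of "inverse r"]
      by (simp add: divide_inverse)
  qed (use Sy in auto)
  then have 0: "(\<lambda>n. shifted T l (y (s n))) \<longlonglongrightarrow> 0"
    using LIMSEQ_subseq_LIMSEQ [OF _ s(1)] by (auto simp: o_def)
  have lim: "(\<lambda>n. y (s n)) \<longlonglongrightarrow> a"
    using s(2) by (simp add: o_def)
  have "(\<lambda>n. cscale l (y (s n)) - shifted T l (y (s n))) \<longlonglongrightarrow> cscale l a - 0"
    by (intro tendsto_intros 0 lim)
  then have lim': "(\<lambda>n. map_prod T T (y (s n))) \<longlonglongrightarrow> cscale l a"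
    by (simp add: shifted_def)
  have a: "a \<in> D \<times> D" "map_prod T T a = cscale l a"
    using self_adjoint_closed_graph [OF self_adjoint_map_prod [OF sa] yD lim lim'] by auto
  have "norm a = inverse r"
    using tendsto_norm [OF lim] by (simp add: ny LIMSEQ_const_iff)
  then have "a \<noteq> 0" using r by auto
  with a l show False
    unfolding point_spectrum_def by blast
qed

text \<open>The lower bound makes \<open>shifted T l\<close> injective with complete range. A
  nonzero vector orthogonal to the range would be an eigenvector for \<open>cnj l\<close>, and
  \<open>l\<close> would be an eigenvalue too.\<close>

lemma compact_resolvent_resolvent_set:
  fixes D :: "'a::{real_inner, complete_space} set"
  assumes sa: "self_adjoint D T" and "compact_resolvent D T" and l: "l \<notin> point_spectrum D T"
  shows "l \<in> resolvent_set UNIV norm D T"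
proof -
  note lin = self_adjoint_linear_operator [OF sa]
  note linS = linear_operator_shifted [OF lin, of l]
  note sub = linear_operator_subspace [OF linS]
  note sa2 = self_adjoint_map_prod [OF sa]
  let ?S = "shifted T l"
  obtain C0 where C0: "\<And>z. z \<in> D \<times> D \<Longrightarrow> norm z \<le> C0 * norm (?S z)"
    using compact_resolvent_bounded_below [OF assms] by auto
  define C where "C = max C0 1"
  have C: "norm z \<le> C * norm (?S z)" if "z \<in> D \<times> D" for z
    using C0 [OF that] by (smt (verit, best) C_def mult_right_mono norm_ge_zero)
  have "C > 0" by (simp add: C_def)
  have inj: "inj_on ?S (D \<times> D)"
  proof (rule inj_onI)
    fix x y assume xy: "x \<in> D \<times> D" "y \<in> D \<times> D" "?S x = ?S y"
    then have "?S (x - y) = 0" "x - y \<in> D \<times> D"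
      using linear_operator_diff [OF linS, of x y] subspace_diff [OF sub] by auto
    then show "x = y" using C [of "x - y"] by simp
  qed
  define R where "R = ?S ` (D \<times> D)"
  have subR: "subspace R"
    unfolding R_def subspace_def
  proof (intro conjI ballI allI)
    show "0 \<in> ?S ` (D \<times> D)"
      using linear_operator_zero [OF linS] subspace_0 [OF sub] by (metis imageI)
  next
    fix x y assume "x \<in> ?S ` (D \<times> D)" "y \<in> ?S ` (D \<times> D)"
    then show "x + y \<in> ?S ` (D \<times> D)"
      using linear_operator_add [OF linS] subspace_add [OF sub] by (smt (verit) imageE imageI)
  next
    fix c x assume "x \<in> ?S ` (D \<times> D)"
    then show "c *\<^sub>R x \<in> ?S ` (D \<times> D)"
      using linear_operator_scaleR [OF linS] subspace_scale [OF sub] by (smt (verit) imageE imageI)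
  qed
  have "complete R"
    unfolding complete_def
  proof (intro allI impI)
    fix f :: "nat \<Rightarrow> 'a \<times> 'a"
    assume f: "(\<forall>n. f n \<in> R) \<and> Cauchy f"
    then have "\<forall>n. \<exists>z. z \<in> D \<times> D \<and> f n = ?S z"
      unfolding R_def by (simp add: image_iff Bex_def)
    then obtain z where z: "\<And>n. z n \<in> D \<times> D" "\<And>n. f n = ?S (z n)"
      by metis
    have "Cauchy z"
    proof (rule metric_CauchyI)
      fix e :: real assume "e > 0"
      with \<open>C > 0\<close> have "e / C > 0" by simp
      then obtain N where N: "\<And>m n. m \<ge> N \<Longrightarrow> n \<ge> N \<Longrightarrow> dist (f m) (f n) < e / C"
        using f metric_CauchyD by blast
      have "dist (z m) (z n) < e" if "m \<ge> N" "n \<ge> N" for m n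
      proof -
        have "norm (z m - z n) \<le> C * norm (f m - f n)"
          using C [of "z m - z n"] linear_operator_diff [OF linS, of "z m" "z n"] z
            subspace_diff [OF sub] by auto
        also have "\<dots> < e"
          using N [OF that] \<open>C > 0\<close> by (simp add: dist_norm field_simps)
        finally show ?thesis by (simp add: dist_norm)
      qed
      then show "\<exists>N. \<forall>m\<ge>N. \<forall>n\<ge>N. dist (z m) (z n) < e" by blast
    qed
    then obtain a where a: "z \<longlonglongrightarrow> a"
      using Cauchy_convergent convergent_def by blast
    obtain b where b: "f \<longlonglongrightarrow> b"
      using f Cauchy_convergent convergent_def by blast
    have "(\<lambda>n. cscale l (z n) - f n) \<longlonglongrightarrow> cscale l a - b"
      by (intro tendsto_intros a b)
    then have "(\<lambda>n. map_prod T T (z n)) \<longlonglongrightarrow> cscale l a - b"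
      by (simp add: z shifted_def)
    then have "a \<in> D \<times> D" "map_prod T T a = cscale l a - b"
      using self_adjoint_closed_graph [OF sa2 z(1) a] by auto
    then have "b \<in> R"
      unfolding R_def by (intro image_eqI [where x = a]) (auto simp: shifted_def)
    with b show "\<exists>l\<in>R. f \<longlonglongrightarrow> l" by blast
  qed
  have "R = UNIV"
  proof (rule ccontr)
    assume "R \<noteq> UNIV"
    then obtain y where y: "y \<noteq> 0" "\<And>m. m \<in> R \<Longrightarrow> inner m y = 0"
      using complete_proper_subspace_orthogonal [OF subR \<open>complete R\<close>] by metis
    \<comment> \<open>Orthogonality to the range of \<open>l - T\<close> is the adjoint condition
      for \<open>y\<close>, with value \<open>cnj l\<close> times \<open>y\<close>.\<close>
    have "inner (map_prod T T x) y = inner x (cscale (cnj l) y)" if "x \<in> D \<times> D" for x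
      using y(2) [of "?S x"] that by (simp add: R_def shifted_def inner_diff_left inner_cscale_left)
    from self_adjointD [OF sa2 this] have "cnj l \<in> point_spectrum D T"
      unfolding point_spectrum_def using y(1) by blast
    with l point_spectrum_cnj [OF lin] show False
      by fastforce
  qed
  then show ?thesis
    using inj C by (auto simp: resolvent_set_def bij_betw_def R_def)
qed

subsection \<open>Square roots\<close>

lemma is_sqrt_ofD:
  assumes "is_sqrt_of V B D A"
  shows "self_adjoint V B" "D = {x \<in> V. B x \<in> V}" "\<And>x. x \<in> D \<Longrightarrow> A x = B (B x)"
  using assms by (auto simp: is_sqrt_of_def)

lemma is_sqrt_of_map_prod:
  assumes "is_sqrt_of V B D A"
  shows "is_sqrt_of (V \<times> V) (map_prod B B) (D \<times> D) (map_prod A A)"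
  using assms self_adjoint_map_prod [of V B] unfolding is_sqrt_of_def
  by (auto simp: inner_prod_def)

context
  fixes V D :: "'a::real_inner set" and A B
  assumes sqrt: "is_sqrt_of V B D A"
begin

lemma norm_sqrt_operator: "x \<in> D \<Longrightarrow> (norm (B x))\<^sup>2 = inner (A x) x"
  using self_adjoint_symmetric [OF is_sqrt_ofD(1) [OF sqrt], of "B x" x] is_sqrt_ofD(2,3) [OF sqrt]
  by (simp add: power2_norm_eq_inner)

text \<open>Write \<open>x = A z\<close>. Then \<open>(norm x)^2\<close> is the inner product of
  \<open>B x\<close> and \<open>B z\<close>, while \<open>(norm (B z))^2\<close> is the inner
  product of \<open>x\<close> and \<open>z\<close>, hence at most
  \<open>C * (norm x)^2\<close>.\<close>

lemma sqrt_operator_bounded_below: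
  assumes C: "\<And>x. x \<in> D \<Longrightarrow> norm x \<le> C * norm (A x)" and surj: "A ` D = UNIV" and x: "x \<in> V"
  shows "norm x \<le> sqrt C * norm (B x)"
proof (cases "x = 0")
  case False
  obtain z where z: "z \<in> D" "A z = x"
    using surj by (metis UNIV_I imageE)
  have "(norm (B z))\<^sup>2 \<le> norm x * norm z"
    using norm_sqrt_operator [OF z(1)] norm_cauchy_schwarz [of x z] z by simp
  also have "\<dots> \<le> norm x * (C * norm x)"
    using C [OF z(1)] z by (intro mult_left_mono) auto
  finally have "norm (B z) \<le> sqrt (norm x * (C * norm x))"
    using real_le_rsqrt by blast
  also have "\<dots> = sqrt C * norm x"
    by (simp add: real_sqrt_mult)
  finally have Bz: "norm (B z) \<le> sqrt C * norm x" .
  have zV: "B z \<in> V" "x = B (B z)"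
    using z is_sqrt_ofD(2,3) [OF sqrt] by auto
  have "(norm x)\<^sup>2 = inner (B x) (B z)"
    using self_adjoint_symmetric [OF is_sqrt_ofD(1) [OF sqrt] x zV(1)] zV(2)
    by (simp add: power2_norm_eq_inner)
  also have "\<dots> \<le> norm (B x) * norm (B z)"
    by (rule norm_cauchy_schwarz)
  also have "\<dots> \<le> norm (B x) * (sqrt C * norm x)"
    using Bz by (intro mult_left_mono) auto
  finally show ?thesis
    using False by (simp add: power2_eq_square mult.commute)
next
  case True
  then show ?thesis
    using linear_operator_zero [OF self_adjoint_linear_operator [OF is_sqrt_ofD(1) [OF sqrt]]]
    by simp
qed

text \<open>This is the core property of \<open>D\<close> for \<open>B\<close>. The image of
  \<open>D\<close> under \<open>B\<close> contains the dense set \<open>V\<close>: if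
  \<open>A z = k\<close> with \<open>k\<close> in \<open>V\<close>, then \<open>B z\<close> lies in
  \<open>D\<close> and \<open>B (B z) = k\<close>.\<close>

lemma sqrt_operator_core:
  assumes surj: "A ` D = UNIV" and e: "e > 0"
  obtains y where "y \<in> D" "norm (B y - B x) < e"
proof -
  have "closure V = UNIV"
    using is_sqrt_ofD(1) [OF sqrt] by (simp add: self_adjoint_def)
  then obtain k where k: "k \<in> V" "norm (k - B x) < e"
    using e by (metis UNIV_I closure_approachable dist_norm)
  obtain z where "z \<in> D" "A z = k"
    using surj by (metis UNIV_I imageE)
  with k have "B z \<in> D" "B (B z) = k"
    using is_sqrt_ofD(2,3) [OF sqrt] by auto
  with k that show ?thesis by metis
qed

end

subsection \<open>Reduction of the third-order operator to \<open>A\<close>\<close>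

text \<open>
  A complexified state is \<open>pack u v w\<close> with \<open>u\<close>, \<open>v\<close>, \<open>w\<close> in the complexification of \<open>H\<close>.
\<close>

definition pack :: "'a \<times> 'a \<Rightarrow> 'a \<times> 'a \<Rightarrow> 'a \<times> 'a \<Rightarrow> ('a \<times> 'a \<times> 'a) \<times> ('a \<times> 'a \<times> 'a)" where
  "pack u v w = ((fst u, fst v, fst w), (snd u, snd v, snd w))"

lemma pack_cases: obtains u v w where "z = pack u v w"
  by (metis pack_def fst_conv snd_conv prod.collapse)

lemma pack_eq_iff [simp]: "pack u v w = pack u' v' w' \<longleftrightarrow> u = u' \<and> v = v' \<and> w = w'"
  by (auto simp: pack_def prod_eq_iff)

lemma pack_zero [simp]: "pack 0 0 0 = 0"
  by (simp add: pack_def zero_prod_def)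

lemma pack_diff: "pack u v w - pack u' v' w' = pack (u - u') (v - v') (w - w')"
  by (simp add: pack_def)

lemma cscale_pack: "cscale l (pack u v w) = pack (cscale l u) (cscale l v) (cscale l w)"
  by (simp add: pack_def cscale_def)

lemma pack_mem_H0_space [simp]:
  "pack u v w \<in> H0_space V \<times> H0_space V \<longleftrightarrow> u \<in> V \<times> V \<and> v \<in> V \<times> V"
  by (auto simp: pack_def H0_space_def mem_Times_iff)

lemma pack_mem_mgt_domain:
  "pack u v w \<in> mgt_domain D V c \<delta> \<tau> \<times> mgt_domain D V c \<delta> \<tau> \<longleftrightarrow>
    u \<in> V \<times> V \<and> v \<in> V \<times> V \<and> w \<in> V \<times> V \<and> c\<^sup>2 *\<^sub>R u + b_coeff c \<delta> \<tau> *\<^sub>R v \<in> D \<times> D"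
  by (auto simp: pack_def mgt_domain_def H0_space_def mem_Times_iff)

lemma shifted_mgt_op_pack:
  "shifted (mgt_op A \<alpha> c \<delta> \<tau>) l (pack u v w) = pack (cscale l u - v) (cscale l v - w)
    (cscale l w + inverse \<tau> *\<^sub>R map_prod A A (c\<^sup>2 *\<^sub>R u + b_coeff c \<delta> \<tau> *\<^sub>R v)
      + (inverse \<tau> * \<alpha>) *\<^sub>R w)"
  by (simp add: shifted_def pack_def mgt_op_def cscale_def)

lemma cnorm_H0_norm_pack:
  "cnorm (H0_norm B) (pack u v w)
    = sqrt ((norm (map_prod B B u))\<^sup>2 + (norm (map_prod B B v))\<^sup>2 + (norm w)\<^sup>2)"
  by (simp add: cnorm_def H0_norm_def pack_def norm_prod_def algebra_simps)

lemma cnorm_H0_norm_pack_le: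
  "cnorm (H0_norm B) (pack u v w) \<le> norm (map_prod B B u) + norm (map_prod B B v) + norm w"
  unfolding cnorm_H0_norm_pack
  by (rule real_le_lsqrt) (auto simp: power2_eq_square algebra_simps)

lemma cnorm_H0_norm_pack_ge:
  "norm (map_prod B B u) \<le> cnorm (H0_norm B) (pack u v w)"
  "norm (map_prod B B v) \<le> cnorm (H0_norm B) (pack u v w)"
  "norm w \<le> cnorm (H0_norm B) (pack u v w)"
  unfolding cnorm_H0_norm_pack by (rule real_le_rsqrt; simp)+

section \<open>The setting and the norm of the state space\<close>

locale mgt =
  fixes A B :: "'a::{real_inner, complete_space} \<Rightarrow> 'a" and D V :: "'a set"
    and \<mu> :: "nat \<Rightarrow> real" and \<alpha> c \<delta> \<tau> :: real
  assumes self_adjoint: "self_adjoint D A"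
    and positive: "\<And>x. x \<in> D \<Longrightarrow> x \<noteq> 0 \<Longrightarrow> 0 < inner (A x) x"
    and compact_resolvent: "compact_resolvent D A"
    and sqrt: "is_sqrt_of V B D A"
    and eigenvalues: "point_spectrum D A = range (\<lambda>n. of_real (\<mu> n))"
    and params: "\<alpha> > 0" "c > 0" "\<delta> > 0" "\<tau> > 0"
begin

abbreviation "b \<equiv> b_coeff c \<delta> \<tau>"
abbreviation "\<AA> \<equiv> map_prod A A"
abbreviation "\<BB> \<equiv> map_prod B B"
abbreviation "dom_T \<equiv> mgt_domain D V c \<delta> \<tau>"
abbreviation "T \<equiv> mgt_op A \<alpha> c \<delta> \<tau>"
abbreviation "N \<equiv> cnorm (H0_norm B)"
text \<open>The factor in \<open>p = q l u - b f\<close>; it vanishes only at the exceptional point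
  \<open>l0\<close>.\<close>

definition q :: "complex \<Rightarrow> complex" where
  "q l = of_real (c\<^sup>2) + of_real b * l"

abbreviation "l0 \<equiv> - c\<^sup>2 / b"

lemma b_pos: "b > 0"
  using params by (simp add: b_coeff_def add_pos_nonneg)

text \<open>Clears the denominator \<tau> from the third component of
  \<open>shifted T l\<close>.\<close>

lemma scaleR_third_component:
  fixes x y z :: "'v::real_vector"
  shows "\<tau> *\<^sub>R (x + inverse \<tau> *\<^sub>R y + (inverse \<tau> * \<alpha>) *\<^sub>R z) = \<tau> *\<^sub>R x + y + \<alpha> *\<^sub>R z"
  using params by (simp add: scaleR_add_right)

lemmas linear_A = self_adjoint_linear_operator [OF self_adjoint]
lemmas sa_B = is_sqrt_ofD(1) [OF sqrt]
lemmas linear_B = self_adjoint_linear_operator [OF sa_B]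
lemmas linear_AA = linear_operator_map_prod [OF linear_A]
lemmas linear_BB = linear_operator_map_prod [OF linear_B]
lemmas sqrt2 = is_sqrt_of_map_prod [OF sqrt]
lemmas subspace_VV = linear_operator_subspace [OF linear_BB]
lemmas subspace_DD = linear_operator_subspace [OF linear_AA]
lemmas cscale_VV = cscale_mem_Times [OF linear_operator_subspace [OF linear_B]]
lemmas cscale_DD = cscale_mem_Times [OF linear_operator_subspace [OF linear_A]]
lemmas VV_closed = subspace_add [OF subspace_VV] subspace_diff [OF subspace_VV]
  subspace_scale [OF subspace_VV] cscale_VV

lemma DD_VV: "D \<times> D \<subseteq> V \<times> V"
  using is_sqrt_ofD(2) [OF sqrt] by auto

lemma resolvent_A:
  "l \<notin> point_spectrum D A \<Longrightarrow> l \<in> resolvent_set UNIV norm D A"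
  by (rule compact_resolvent_resolvent_set [OF self_adjoint compact_resolvent])

lemma eigenvalue_pos: "\<mu> n > 0"
proof -
  have "of_real (\<mu> n) \<in> point_spectrum D A"
    using eigenvalues by auto
  then obtain x where x: "x \<in> D" "x \<noteq> 0" "A x = \<mu> n *\<^sub>R x"
    using point_spectrum_eigenvector [OF linear_A] by blast
  have "0 < \<mu> n * inner x x"
    using positive [OF x(1,2)] x(3) by simp
  moreover have "inner x x > 0"
    using x(2) by simp
  ultimately show ?thesis
    by (rule zero_less_mult_pos2)
qed

lemma AA_invertible:
  obtains C where "\<And>z. z \<in> D \<times> D \<Longrightarrow> norm z \<le> C * norm (\<AA> z)" "\<AA> ` (D \<times> D) = UNIV"
proof -
  have "0 \<notin> point_spectrum D A"
  proof
    assume "0 \<in> point_spectrum D A"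
    then obtain n where "\<mu> n = 0"
      using eigenvalues by auto
    with eigenvalue_pos [of n] show False by simp
  qed
  then have "0 \<in> resolvent_set UNIV norm D A"
    by (rule resolvent_A)
  moreover have S: "shifted A 0 = (\<lambda>z. - \<AA> z)"
    by (auto simp: shifted_def fun_eq_iff)
  ultimately obtain C where C: "\<And>z. z \<in> D \<times> D \<Longrightarrow> norm z \<le> C * norm (\<AA> z)"
    and surj: "(\<lambda>z. - \<AA> z) ` (D \<times> D) = UNIV"
    by (auto simp: resolvent_set_def S bij_betw_def simp del: map_prod_simp)
  have "\<AA> ` (D \<times> D) = uminus ` (\<lambda>z. - \<AA> z) ` (D \<times> D)"
    by (simp add: image_image)
  then have "\<AA> ` (D \<times> D) = UNIV"
    unfolding surj by simp
  with C that show ?thesis by blast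
qed

text \<open>Makes \<open>norm (\<BB> u)\<close> a norm on \<open>V \<times> V\<close> that controls
  the norm of \<open>H\<close>; this gives definiteness of \<open>N\<close> and bounds for the data
  in \<open>H\<close>.\<close>

lemma BB_bounded_below:
  obtains K where "K \<ge> 0" "\<And>z. z \<in> V \<times> V \<Longrightarrow> norm z \<le> K * norm (\<BB> z)"
proof -
  obtain C where C: "\<And>z. z \<in> D \<times> D \<Longrightarrow> norm z \<le> C * norm (\<AA> z)" "\<AA> ` (D \<times> D) = UNIV"
    using AA_invertible by blast
  have "norm z \<le> max 0 (sqrt C) * norm (\<BB> z)" if "z \<in> V \<times> V" for z
    using sqrt_operator_bounded_below [OF sqrt2 C that]
    by (smt (verit) mult_right_mono norm_ge_zero)
  then show ?thesis
    using that [of "max 0 (sqrt C)"] by simp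
qed

lemma N_pos:
  assumes "z \<in> dom_T \<times> dom_T" "z \<noteq> 0"
  shows "N z > 0"
proof -
  obtain u v w where z: "z = pack u v w" by (rule pack_cases)
  obtain K where K: "\<And>z. z \<in> V \<times> V \<Longrightarrow> norm z \<le> K * norm (\<BB> z)"
    using BB_bounded_below by blast
  have uv: "u \<in> V \<times> V" "v \<in> V \<times> V"
    using assms(1) by (auto simp: z pack_mem_mgt_domain)
  show ?thesis
  proof (rule ccontr)
    assume "\<not> N z > 0"
    then have "N (pack u v w) \<le> 0"
      by (simp add: z)
    then have "norm (\<BB> u) \<le> 0" "norm (\<BB> v) \<le> 0" "norm w \<le> 0"
      by (rule order_trans [OF cnorm_H0_norm_pack_ge(1)] order_trans [OF cnorm_H0_norm_pack_ge(2)]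
          order_trans [OF cnorm_H0_norm_pack_ge(3)]; assumption)+
    with K [OF uv(1)] K [OF uv(2)] have "z = pack 0 0 0"
      by (simp add: z)
    with assms(2) show False by simp
  qed
qed

lemma N_cscale:
  assumes "z \<in> dom_T \<times> dom_T"
  shows "N (cscale l z) = cmod l * N z"
proof -
  obtain u v w where z: "z = pack u v w" by (rule pack_cases)
  have uv: "u \<in> V \<times> V" "v \<in> V \<times> V"
    using assms by (auto simp: z pack_mem_mgt_domain)
  show ?thesis
    unfolding z cscale_pack cnorm_H0_norm_pack
    by (simp add: map_prod_cscale [OF linear_B] uv norm_cscale power_mult_distrib real_sqrt_mult
        flip: distrib_left)
qed

section \<open>The cubic and its exceptional point\<close>

lemma cubic_eq: "mgt_cubic \<alpha> c \<delta> \<tau> m l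
    = (of_real \<tau> * l + of_real \<alpha>) * l\<^sup>2 + of_real m * q l"
  by (simp add: mgt_cubic_def q_def algebra_simps power2_eq_square power3_eq_cube)

lemma q_zero_iff: "q l = 0 \<longleftrightarrow> l = of_real l0"
proof -
  have "b * l0 = - c\<^sup>2"
    using b_pos by simp
  then have "complex_of_real (b * l0) = of_real (- c\<^sup>2)"
    by (simp only:)
  then have "of_real b * of_real l0 = (- of_real (c\<^sup>2) :: complex)"
    by (simp only: of_real_mult of_real_minus)
  then have "q l = of_real b * (l - of_real l0)"
    by (simp only: q_def right_diff_distrib diff_minus_eq_add add.commute)
  then show ?thesis
    using b_pos by (simp add: eq_neg_iff_add_eq_0)
qed

lemma gamma_eq: "\<tau> * l0 + \<alpha> = gamma_coeff \<alpha> c \<delta> \<tau>"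
  using b_pos by (simp add: gamma_coeff_def divide_inverse)

text \<open>Since \<open>q\<close> vanishes here, the value does not depend on \<open>m\<close>: the
  point is a root for all \<open>m\<close> or for none, according to whether \<gamma> is
  zero.\<close>

lemma cubic_at_limit: "mgt_cubic \<alpha> c \<delta> \<tau> m (of_real l0) = of_real (gamma_coeff \<alpha> c \<delta> \<tau> * l0\<^sup>2)"
proof -
  have "q (of_real l0) = 0"
    using q_zero_iff by blast
  then show ?thesis
    unfolding cubic_eq gamma_eq [symmetric] by simp
qed

text \<open>
  The right-hand side \<open>F\<close> of the equation \<open>(- \<kappa> - A) p = F\<close> for \<open>p = c\<^sup>2 u + b v = q l u - b f\<close>.
\<close>

definition resolvent_rhs where
  "resolvent_rhs l \<kappa> f g h = cscale (\<kappa> * of_real b - (of_real \<tau> * l + of_real \<alpha>) * l) f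
    - cscale (of_real \<tau> * l + of_real \<alpha>) g - cscale (of_real \<tau>) (h :: 'a \<times> 'a)"

text \<open>The first two components express \<open>v\<close> and \<open>w\<close> through
  \<open>u\<close>. In the third, the remaining \<open>u\<close>-term is
  \<open>(\<tau> l + \<alpha>) l^2 u = \<kappa> (q l) u\<close>, which
  \<open>p = q l u - b f\<close> turns into a multiple of \<open>p\<close> plus a term in
  \<open>f\<close>.\<close>

lemma resolvent_equation_reduce:
  assumes \<kappa>: "\<kappa> * q l = (of_real \<tau> * l + of_real \<alpha>) * l\<^sup>2"
    and eq: "shifted T l (pack u v w) = pack f g h"
  defines "p \<equiv> c\<^sup>2 *\<^sub>R u + b *\<^sub>R v"
  shows "shifted A (- \<kappa>) p = resolvent_rhs l \<kappa> f g h"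
    and "cscale (q l) u = p + cscale (of_real b) f"
    and "v = cscale l u - f" "w = cscale l v - g"
proof -
  have f: "f = cscale l u - v" and g: "g = cscale l v - w"
    and h: "h = cscale l w + inverse \<tau> *\<^sub>R \<AA> p + (inverse \<tau> * \<alpha>) *\<^sub>R w"
    using eq by (auto simp: shifted_mgt_op_pack p_def)
  show v: "v = cscale l u - f" and w: "w = cscale l v - g"
    by (simp_all add: f g)
  \<comment> \<open>Real multiples are rewritten as complex ones so that they combine with
    \<open>l\<close> under the laws for \<open>cscale\<close>.\<close>
  have p: "p = cscale (of_real (c\<^sup>2)) u + cscale (of_real b) v"
    by (simp only: p_def cscale_of_real)
  show u: "cscale (q l) u = p + cscale (of_real b) f"
    unfolding p v q_def by (simp add: algebra_simps del: cscale_of_real of_real_power)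
  have "\<tau> *\<^sub>R h = \<tau> *\<^sub>R cscale l w + \<AA> p + \<alpha> *\<^sub>R w"
    by (simp only: h scaleR_third_component)
  then have "\<AA> p = \<tau> *\<^sub>R h - \<tau> *\<^sub>R cscale l w - \<alpha> *\<^sub>R w"
    by (simp add: algebra_simps)
  then have Ap: "\<AA> p = cscale (of_real \<tau>) h - cscale (of_real \<tau>) (cscale l w) - cscale (of_real \<alpha>) w"
    by (simp only: cscale_of_real)
  have "cscale \<kappa> p = cscale \<kappa> (cscale (q l) u - cscale (of_real b) f)"
    by (simp add: u)
  also have "\<dots> = cscale ((of_real \<tau> * l + of_real \<alpha>) * l\<^sup>2) u - cscale (\<kappa> * of_real b) f"
    by (simp only: cscale.scale_right_diff_distrib cscale.scale_scale \<kappa>)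
  finally have "cscale \<kappa> p = \<dots>" .
  then show "shifted A (- \<kappa>) p = resolvent_rhs l \<kappa> f g h"
    unfolding shifted_def Ap resolvent_rhs_def w v
    by (simp add: algebra_simps power2_eq_square del: cscale_of_real)
qed

text \<open>Reverses the reduction: \<open>u\<close> is recovered from \<open>p\<close> by dividing
  by \<open>q l\<close>, then \<open>v\<close> and \<open>w\<close> are forced. Since
  \<open>c^2 u + b v\<close> gives back \<open>p\<close>, the domain condition is just that
  \<open>p\<close> lies in \<open>D \<times> D\<close>.\<close>

lemma resolvent_equation_solve:
  assumes \<kappa>: "\<kappa> * q l = (of_real \<tau> * l + of_real \<alpha>) * l\<^sup>2"
    and "p \<in> D \<times> D" "f \<in> V \<times> V" "g \<in> V \<times> V"
    and p: "shifted A (- \<kappa>) p = resolvent_rhs l \<kappa> f g h"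
    and q: "q l \<noteq> 0"
  obtains z where "z \<in> dom_T \<times> dom_T" "shifted T l z = pack f g h"
proof -
  define u where "u = cscale (inverse (q l)) (p + cscale (of_real b) f)"
  define v where "v = cscale l u - f"
  define w where "w = cscale l v - g"
  have u: "cscale (q l) u = p + cscale (of_real b) f"
    using q by (simp add: u_def)
  have "c\<^sup>2 *\<^sub>R u + b *\<^sub>R v = cscale (of_real (c\<^sup>2)) u + cscale (of_real b) v"
    by (simp only: cscale_of_real)
  also have "\<dots> = cscale (q l) u - cscale (of_real b) f"
    unfolding v_def q_def by (simp add: algebra_simps del: cscale_of_real of_real_power)
  finally have p_eq: "c\<^sup>2 *\<^sub>R u + b *\<^sub>R v = p"
    by (simp add: u)
  have "p \<in> V \<times> V" using assms(2) DD_VV by blast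
  then have uV: "u \<in> V \<times> V"
    unfolding u_def using assms(3) by (intro VV_closed)
  then have vV: "v \<in> V \<times> V"
    unfolding v_def using assms(3) by (intro VV_closed)
  then have "w \<in> V \<times> V"
    unfolding w_def using assms(4) by (intro VV_closed)
  with uV vV have mem: "pack u v w \<in> dom_T \<times> dom_T"
    unfolding pack_mem_mgt_domain p_eq using assms(2) by blast
  have "cscale \<kappa> p = cscale \<kappa> (cscale (q l) u - cscale (of_real b) f)"
    by (simp add: u)
  also have "\<dots> = cscale ((of_real \<tau> * l + of_real \<alpha>) * l\<^sup>2) u - cscale (\<kappa> * of_real b) f"
    by (simp only: cscale.scale_right_diff_distrib cscale.scale_scale \<kappa>)
  finally have \<kappa>p: "cscale \<kappa> p = \<dots>" .
  have "\<AA> p = - cscale \<kappa> p - resolvent_rhs l \<kappa> f g h"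
    using p by (simp add: shifted_def algebra_simps)
  also have "\<dots> = cscale (of_real \<tau>) h - cscale (of_real \<tau>) (cscale l w) - cscale (of_real \<alpha>) w"
    unfolding \<kappa>p resolvent_rhs_def w_def v_def
    by (simp add: algebra_simps power2_eq_square del: cscale_of_real)
  finally have "\<AA> p = \<tau> *\<^sub>R h - \<tau> *\<^sub>R cscale l w - \<alpha> *\<^sub>R w"
    by (simp only: cscale_of_real)
  then have "cscale l w + inverse \<tau> *\<^sub>R \<AA> p + (inverse \<tau> * \<alpha>) *\<^sub>R w = h"
    using params by (simp add: scaleR_diff_right)
  then have "shifted T l (pack u v w) = pack f g h"
    unfolding shifted_mgt_op_pack p_eq by (simp add: v_def w_def)
  with mem show ?thesis by (rule that)
qed

text \<open>The bound for \<open>- \<kappa> - A\<close> controls \<open>p\<close> in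
  \<open>H\<close>, the equation then controls \<open>\<AA> p\<close>, and interpolation controls
  \<open>\<BB> p\<close>. From there the energy norms of \<open>u\<close> and \<open>v\<close> and
  the norm of \<open>w\<close> follow.\<close>

lemma resolvent_bounded_below:
  assumes \<kappa>: "\<kappa> * q l = (of_real \<tau> * l + of_real \<alpha>) * l\<^sup>2"
    and q: "q l \<noteq> 0"
    and C0: "\<And>z. z \<in> D \<times> D \<Longrightarrow> norm z \<le> C0 * norm (shifted A (- \<kappa>) z)"
  shows "\<exists>C. \<forall>z\<in>dom_T \<times> dom_T. N z \<le> C * N (shifted T l z)"
proof -
  obtain K where K: "K \<ge> 0" "\<And>z. z \<in> V \<times> V \<Longrightarrow> norm z \<le> K * norm (\<BB> z)"
    using BB_bounded_below by blast
  define C where "C = max 0 C0"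
  have C: "C \<ge> 0" by (simp add: C_def)
  have CA: "norm z \<le> C * norm (shifted A (- \<kappa>) z)" if "z \<in> D \<times> D" for z
    by (rule order_trans [OF C0 [OF that]]) (simp add: C_def mult_right_mono)
  define c1 where "c1 = cmod (\<kappa> * of_real b - (of_real \<tau> * l + of_real \<alpha>) * l)"
  define c2 where "c2 = cmod (of_real \<tau> * l + of_real \<alpha>)"
  \<comment> \<open>As multiples of the norm \<open>E\<close> of the data, \<open>M1\<close> bounds
    the right-hand side, \<open>M2\<close> bounds \<open>p\<close>, \<open>M3\<close> bounds
    \<open>\<AA> p\<close>, \<open>M4\<close> bounds \<open>\<BB> p\<close>, and \<open>M5\<close>,
    \<open>M6\<close>, \<open>M7\<close> bound \<open>\<BB> u\<close>, \<open>\<BB> v\<close>,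
    \<open>w\<close>.\<close>
  define M1 where "M1 = c1 * K + c2 * K + \<tau>"
  define M2 where "M2 = C * M1"
  define M3 where "M3 = cmod \<kappa> * M2 + M1"
  define M4 where "M4 = sqrt (M3 * M2)"
  define M5 where "M5 = (M4 + b) / cmod (q l)"
  define M6 where "M6 = cmod l * M5 + 1"
  define M7 where "M7 = cmod l * (K * M6) + K"
  have "N z \<le> (M5 + M6 + M7) * N (shifted T l z)" if z: "z \<in> dom_T \<times> dom_T" for z
  proof -
    obtain u v w where uvw: "z = pack u v w" by (rule pack_cases)
    obtain f g h where fgh: "shifted T l z = pack f g h" by (rule pack_cases)
    define E where "E = N (pack f g h)"
    define p where "p = c\<^sup>2 *\<^sub>R u + b *\<^sub>R v"
    have mem: "u \<in> V \<times> V" "v \<in> V \<times> V" "w \<in> V \<times> V" "p \<in> D \<times> D"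
      using z by (auto simp: uvw pack_mem_mgt_domain p_def)
    note red = resolvent_equation_reduce [OF \<kappa> fgh [unfolded uvw], folded p_def]
    have "f = cscale l u - v" "g = cscale l v - w"
      by (simp_all add: red(3,4))
    then have fg: "f \<in> V \<times> V" "g \<in> V \<times> V"
      using mem by (auto intro!: VV_closed simp del: mem_Times_iff)
    have Bf: "norm (\<BB> f) \<le> E" and Bg: "norm (\<BB> g) \<le> E" and h: "norm h \<le> E"
      unfolding E_def by (rule cnorm_H0_norm_pack_ge)+
    have E: "E \<ge> 0" using norm_ge_zero h by (rule order_trans)
    have f: "norm f \<le> K * E" and g: "norm g \<le> K * E"
      using K(2) [OF fg(1)] K(2) [OF fg(2)] mult_left_mono [OF Bf K(1)] mult_left_mono [OF Bg K(1)]
      by linarith+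
    have "norm (resolvent_rhs l \<kappa> f g h) \<le> c1 * norm f + c2 * norm g + \<tau> * norm h"
      unfolding resolvent_rhs_def c1_def c2_def
      using params by (intro norm_triangle_le_diff add_mono) (auto simp: norm_cscale)
    also have "\<dots> \<le> c1 * (K * E) + c2 * (K * E) + \<tau> * E"
      using f g h params by (intro add_mono mult_left_mono) (auto simp: c1_def c2_def)
    finally have F: "norm (resolvent_rhs l \<kappa> f g h) \<le> M1 * E"
      by (simp add: M1_def algebra_simps)
    have p: "norm p \<le> M2 * E"
      using CA [OF mem(4)] mult_left_mono [OF F C] by (simp add: red(1) M2_def)
    have "\<AA> p = - cscale \<kappa> p - resolvent_rhs l \<kappa> f g h"
      using red(1) by (simp add: shifted_def algebra_simps)
    then have "norm (\<AA> p) \<le> cmod \<kappa> * norm p + norm (resolvent_rhs l \<kappa> f g h)"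
      using norm_triangle_ineq4 [of "- cscale \<kappa> p" "resolvent_rhs l \<kappa> f g h"] by (simp add: norm_cscale)
    also have "\<dots> \<le> cmod \<kappa> * (M2 * E) + M1 * E"
      using p F by (intro add_mono mult_left_mono) auto
    finally have Ap: "norm (\<AA> p) \<le> M3 * E"
      by (simp add: M3_def algebra_simps)
    have "(norm (\<BB> p))\<^sup>2 \<le> norm (\<AA> p) * norm p"
      using norm_sqrt_operator [OF sqrt2 mem(4)] norm_cauchy_schwarz [of "\<AA> p" p] by simp
    also have "\<dots> \<le> (M3 * E) * (M2 * E)"
      by (intro mult_mono Ap p norm_ge_zero order_trans [OF norm_ge_zero Ap])
    finally have "norm (\<BB> p) \<le> sqrt ((M3 * E) * (M2 * E))"
      using real_le_rsqrt by blast
    also have "(M3 * E) * (M2 * E) = (M3 * M2) * E\<^sup>2"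
      by (simp add: power2_eq_square)
    finally have Bp: "norm (\<BB> p) \<le> M4 * E"
      using E by (simp add: M4_def real_sqrt_mult)
    have pV: "p \<in> V \<times> V" and bf: "cscale (of_real b) f \<in> V \<times> V"
      using mem(4) DD_VV fg(1) cscale_VV by blast+
    have "cscale (q l) (\<BB> u) = \<BB> (p + cscale (of_real b) f)"
      by (simp only: red(2) flip: map_prod_cscale [OF linear_B mem(1)])
    also have "\<dots> = \<BB> p + cscale (of_real b) (\<BB> f)"
      by (simp only: linear_operator_add [OF linear_BB pV bf] map_prod_cscale [OF linear_B fg(1)])
    finally have "norm (cscale (q l) (\<BB> u)) \<le> norm (\<BB> p) + norm (cscale (of_real b) (\<BB> f))"
      by (simp only: norm_triangle_ineq)
    then have "cmod (q l) * norm (\<BB> u) \<le> norm (\<BB> p) + b * norm (\<BB> f)"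
      using b_pos by (simp only: norm_cscale norm_of_real abs_of_pos)
    also have "\<dots> \<le> M4 * E + b * E"
      using Bp Bf b_pos by (intro add_mono mult_left_mono) auto
    finally have Bu: "norm (\<BB> u) \<le> M5 * E"
      using q by (simp add: M5_def field_simps)
    have "\<BB> v = cscale l (\<BB> u) - \<BB> f"
      by (subst red(3)) (simp only: linear_operator_diff [OF linear_BB cscale_VV [OF mem(1)] fg(1)]
          map_prod_cscale [OF linear_B mem(1)])
    then have "norm (\<BB> v) \<le> cmod l * norm (\<BB> u) + norm (\<BB> f)"
      by (simp only: norm_triangle_ineq4 flip: norm_cscale)
    also have "\<dots> \<le> cmod l * (M5 * E) + E"
      using Bu Bf by (intro add_mono mult_left_mono) auto
    finally have Bv: "norm (\<BB> v) \<le> M6 * E"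
      by (simp add: M6_def algebra_simps)
    have "norm w \<le> cmod l * norm v + norm g"
      by (subst red(4)) (simp only: norm_triangle_ineq4 flip: norm_cscale)
    also have "\<dots> \<le> cmod l * (K * (M6 * E)) + K * E"
      using K(2) [OF mem(2)] mult_left_mono [OF Bv K(1)] g
      by (intro add_mono mult_left_mono) auto
    finally have w: "norm w \<le> M7 * E"
      by (simp add: M7_def algebra_simps)
    have "N z \<le> norm (\<BB> u) + norm (\<BB> v) + norm w"
      unfolding uvw by (rule cnorm_H0_norm_pack_le)
    also have "\<dots> \<le> (M5 + M6 + M7) * E"
      using Bu Bv w by (simp add: algebra_simps)
    finally show ?thesis
      by (simp add: E_def fgh)
  qed
  then show ?thesis by blast
qed

text \<open>\<open>- \<kappa> = \<mu> n\<close> would make the cubic vanish, so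
  \<open>- \<kappa>\<close> lies in the resolvent set of \<open>A\<close>; bijectivity and the bound
  pass back through the reduction.\<close>

lemma mgt_resolvent_set:
  assumes q: "q l \<noteq> 0" and cubic: "\<And>n. mgt_cubic \<alpha> c \<delta> \<tau> (\<mu> n) l \<noteq> 0"
  shows "l \<in> resolvent_set (H0_space V) (H0_norm B) dom_T T"
proof -
  define \<kappa> where "\<kappa> = (of_real \<tau> * l + of_real \<alpha>) * l\<^sup>2 / q l"
  have \<kappa>: "\<kappa> * q l = (of_real \<tau> * l + of_real \<alpha>) * l\<^sup>2"
    using q by (simp add: \<kappa>_def)
  have "- \<kappa> \<notin> point_spectrum D A"
  proof
    assume "- \<kappa> \<in> point_spectrum D A"
    then obtain n where "of_real (\<mu> n) = - \<kappa>"
      using eigenvalues by auto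
    then have "mgt_cubic \<alpha> c \<delta> \<tau> (\<mu> n) l = 0"
      unfolding cubic_eq \<kappa> [symmetric] by simp
    with cubic show False by blast
  qed
  then have "- \<kappa> \<in> resolvent_set UNIV norm D A"
    by (rule resolvent_A)
  then obtain C where inj: "inj_on (shifted A (- \<kappa>)) (D \<times> D)"
    and surj: "shifted A (- \<kappa>) ` (D \<times> D) = UNIV"
    and C: "\<And>z. z \<in> D \<times> D \<Longrightarrow> norm z \<le> C * norm (shifted A (- \<kappa>) z)"
    by (auto simp: resolvent_set_def bij_betw_def)
  have "inj_on (shifted T l) (dom_T \<times> dom_T)"
  proof (rule inj_onI)
    fix z z' assume z: "z \<in> dom_T \<times> dom_T" "z' \<in> dom_T \<times> dom_T" and eq: "shifted T l z = shifted T l z'"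
    obtain u v w where uvw: "z = pack u v w" by (rule pack_cases)
    obtain u' v' w' where uvw': "z' = pack u' v' w'" by (rule pack_cases)
    obtain f g h where fgh: "shifted T l z = pack f g h" by (rule pack_cases)
    note red = resolvent_equation_reduce [OF \<kappa> fgh [unfolded uvw]]
    note red' = resolvent_equation_reduce [OF \<kappa> fgh [unfolded eq uvw']]
    have "c\<^sup>2 *\<^sub>R u + b *\<^sub>R v \<in> D \<times> D" "c\<^sup>2 *\<^sub>R u' + b *\<^sub>R v' \<in> D \<times> D"
      using z unfolding uvw uvw' pack_mem_mgt_domain by blast+
    then have "c\<^sup>2 *\<^sub>R u + b *\<^sub>R v = c\<^sup>2 *\<^sub>R u' + b *\<^sub>R v'"
      by (rule inj_onD [OF inj, rotated]) (simp only: red(1) red'(1))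
    then have "cscale (q l) u = cscale (q l) u'"
      using red(2) red'(2) by simp
    then have u: "u = u'"
      using q by simp
    then have "v = v'"
      using red(3) red'(3) by simp
    with u show "z = z'"
      using red(4) red'(4) by (simp add: uvw uvw')
  qed
  moreover have "shifted T l ` (dom_T \<times> dom_T) = H0_space V \<times> H0_space V"
  proof (intro equalityI subsetI)
    fix y assume "y \<in> shifted T l ` (dom_T \<times> dom_T)"
    then obtain z where z: "z \<in> dom_T \<times> dom_T" "y = shifted T l z" by blast
    obtain u v w where uvw: "z = pack u v w" by (rule pack_cases)
    show "y \<in> H0_space V \<times> H0_space V"
      using z(1) unfolding z(2) uvw pack_mem_mgt_domain shifted_mgt_op_pack pack_mem_H0_space
      by (intro conjI VV_closed) auto
  next
    fix y assume y: "y \<in> H0_space V \<times> H0_space V"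
    obtain f g h where fgh: "y = pack f g h" by (rule pack_cases)
    obtain p where "p \<in> D \<times> D" "shifted A (- \<kappa>) p = resolvent_rhs l \<kappa> f g h"
      using surj by (metis UNIV_I imageE)
    then show "y \<in> shifted T l ` (dom_T \<times> dom_T)"
      using resolvent_equation_solve [OF \<kappa> _ _ _ _ q, of p f g h] y
      unfolding fgh pack_mem_H0_space by (metis image_eqI)
  qed
  ultimately show ?thesis
    using resolvent_bounded_below [OF \<kappa> q C] by (simp add: resolvent_set_def bij_betw_def)
qed

section \<open>The point spectrum\<close>

lemma mgt_point_spectrum: "point_spectrum dom_T T = {l. \<exists>n. mgt_cubic \<alpha> c \<delta> \<tau> (\<mu> n) l = 0}"
proof (intro equalityI subsetI CollectI)
  fix l assume "l \<in> point_spectrum dom_T T"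
  then obtain z where z: "z \<in> dom_T \<times> dom_T" "z \<noteq> 0" "shifted T l z = 0"
    by (auto simp: point_spectrum_def shifted_def simp del: mem_Times_iff)
  obtain u v w where uvw: "z = pack u v w" by (rule pack_cases)
  define p where "p = c\<^sup>2 *\<^sub>R u + b *\<^sub>R v"
  have eq: "shifted T l (pack u v w) = pack 0 0 0"
    using z(3) by (simp add: uvw)
  then have v: "v = cscale l u" and w: "w = cscale l v"
    and h: "cscale l w + inverse \<tau> *\<^sub>R \<AA> p + (inverse \<tau> * \<alpha>) *\<^sub>R w = 0"
    by (simp_all add: shifted_mgt_op_pack p_def del: pack_zero)
  have "u \<noteq> 0"
    using z(2) v w by (auto simp: uvw)
  have pD: "p \<in> D \<times> D"
    using z(1) by (simp add: uvw pack_mem_mgt_domain p_def)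
  have p: "p = cscale (q l) u"
    by (simp add: p_def v q_def cscale.scale_left_distrib flip: cscale.scale_scale of_real_power)
  show "\<exists>n. mgt_cubic \<alpha> c \<delta> \<tau> (\<mu> n) l = 0"
  proof (cases "q l = 0")
    case True
    then have "\<AA> p = 0"
      using p linear_operator_zero [OF linear_AA] by simp
    moreover have "\<tau> *\<^sub>R cscale l w + \<AA> p + \<alpha> *\<^sub>R w = 0"
      by (simp only: h scaleR_zero_right flip: scaleR_third_component)
    ultimately have "\<tau> *\<^sub>R cscale l w + \<alpha> *\<^sub>R w = 0"
      by simp
    then have "cscale (of_real \<tau>) (cscale l w) + cscale (of_real \<alpha>) w = 0"
      by (simp only: cscale_of_real)
    then have "cscale ((of_real \<tau> * l + of_real \<alpha>) * l\<^sup>2) u = 0"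
      unfolding w v by (simp add: algebra_simps power2_eq_square del: cscale_of_real)
    then have "(of_real \<tau> * l + of_real \<alpha>) * l\<^sup>2 = 0"
      using \<open>u \<noteq> 0\<close> by (metis cscale.scale_eq_0_iff)
    with True show ?thesis
      unfolding cubic_eq by simp
  next
    case False
    define \<kappa> where "\<kappa> = (of_real \<tau> * l + of_real \<alpha>) * l\<^sup>2 / q l"
    have \<kappa>: "\<kappa> * q l = (of_real \<tau> * l + of_real \<alpha>) * l\<^sup>2"
      using False by (simp add: \<kappa>_def)
    have "shifted A (- \<kappa>) p = 0"
      using resolvent_equation_reduce(1) [OF \<kappa> eq] by (simp add: p_def resolvent_rhs_def)
    then have "\<AA> p = cscale (- \<kappa>) p"
      by (simp add: shifted_def)
    moreover have "p \<noteq> 0"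
      using False \<open>u \<noteq> 0\<close> unfolding p by (metis cscale.scale_eq_0_iff)
    ultimately have "- \<kappa> \<in> point_spectrum D A"
      using pD unfolding point_spectrum_def by blast
    then obtain n where "of_real (\<mu> n) = - \<kappa>"
      using eigenvalues by auto
    then have "mgt_cubic \<alpha> c \<delta> \<tau> (\<mu> n) l = 0"
      unfolding cubic_eq \<kappa> [symmetric] by simp
    then show ?thesis ..
  qed
next
  fix l assume "l \<in> {l. \<exists>n. mgt_cubic \<alpha> c \<delta> \<tau> (\<mu> n) l = 0}"
  then obtain n where n: "mgt_cubic \<alpha> c \<delta> \<tau> (\<mu> n) l = 0" by blast
  have "of_real (\<mu> n) \<in> point_spectrum D A"
    using eigenvalues by auto
  then obtain e where e: "e \<in> D \<times> D" "e \<noteq> 0" "\<AA> e = cscale (of_real (\<mu> n)) e"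
    unfolding point_spectrum_def by blast
  \<comment> \<open>The first two components force the form \<open>(u, l u, l^2 u)\<close>; then
    \<open>p = q l u\<close>, and an eigenvector of \<open>A\<close> serves as
    \<open>u\<close>.\<close>
  define z where "z = pack e (cscale l e) (cscale (l\<^sup>2) e)"
  have p: "c\<^sup>2 *\<^sub>R e + b *\<^sub>R cscale l e = cscale (q l) e"
    by (simp add: q_def cscale.scale_left_distrib flip: cscale.scale_scale of_real_power)
  have "e \<in> V \<times> V" using e(1) DD_VV by blast
  then have "z \<in> dom_T \<times> dom_T"
    unfolding z_def pack_mem_mgt_domain p using e(1) by (intro conjI cscale_VV cscale_DD)
  moreover have "z \<noteq> 0"
    using e(2) unfolding z_def pack_zero [symmetric] pack_eq_iff by simp
  moreover have "shifted T l z = 0"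
  proof -
    have "\<tau> *\<^sub>R (cscale l (cscale (l\<^sup>2) e) + inverse \<tau> *\<^sub>R \<AA> (cscale (q l) e)
          + (inverse \<tau> * \<alpha>) *\<^sub>R cscale (l\<^sup>2) e)
        = cscale (of_real \<tau>) (cscale l (cscale (l\<^sup>2) e)) + cscale (q l) (cscale (of_real (\<mu> n)) e)
          + cscale (of_real \<alpha>) (cscale (l\<^sup>2) e)"
      by (simp only: scaleR_third_component map_prod_cscale [OF linear_A e(1)] e(3) cscale_of_real)
    also have "\<dots> = cscale (mgt_cubic \<alpha> c \<delta> \<tau> (\<mu> n) l) e"
      unfolding cubic_eq by (simp add: algebra_simps power2_eq_square del: cscale_of_real)
    also have "\<dots> = 0"
      by (simp add: n)
    finally show ?thesis
      unfolding z_def shifted_mgt_op_pack p pack_zero [symmetric] pack_eq_iff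
      using params by (simp add: power2_eq_square)
  qed
  ultimately show "l \<in> point_spectrum dom_T T"
    unfolding point_spectrum_def shifted_def by fastforce
qed

text \<open>At \<open>l0\<close> the equation forces \<open>p = - b f\<close>, so \<open>f\<close>
  must lie in \<open>D \<times> D\<close>, and the third component reads
  \<open>\<tau> h = \<gamma> w - b \<AA> f\<close>. The core property allows \<open>f\<close> to be
  perturbed into \<open>D \<times> D\<close>, and density of \<open>V\<close> allows
  \<open>h\<close> to be perturbed until \<open>w\<close> lies in
  \<open>V \<times> V\<close>.\<close>

lemma mgt_dense_range:
  assumes \<gamma>: "gamma_coeff \<alpha> c \<delta> \<tau> \<noteq> 0"
  shows "dense_range (H0_space V) (H0_norm B) dom_T T (of_real l0)"
  unfolding dense_range_def
proof (intro ballI allI impI)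
  fix y e assume y: "y \<in> H0_space V \<times> H0_space V" and e: "(e::real) > 0"
  define \<gamma> where "\<gamma> = gamma_coeff \<alpha> c \<delta> \<tau>"
  obtain f g h where fgh: "y = pack f g h" by (rule pack_cases)
  have fg: "f \<in> V \<times> V" "g \<in> V \<times> V"
    using y unfolding fgh pack_mem_H0_space by auto
  have surj: "\<AA> ` (D \<times> D) = UNIV" using AA_invertible by blast
  have "e / 2 > 0" using e by simp
  then obtain f' where f': "f' \<in> D \<times> D" "norm (\<BB> f' - \<BB> f) < e / 2"
    by (rule sqrt_operator_core [OF sqrt2 surj])
  have "closure (V \<times> V) = UNIV"
    using is_sqrt_ofD(1) [OF sqrt2] by (simp add: self_adjoint_def)
  then have "\<tau> *\<^sub>R h + b *\<^sub>R \<AA> f' \<in> closure (V \<times> V)" by simp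
  moreover have "\<tau> * (e / 2) > 0" using e params by simp
  ultimately obtain k where k: "k \<in> V \<times> V" "norm (k - (\<tau> *\<^sub>R h + b *\<^sub>R \<AA> f')) < \<tau> * (e / 2)"
    unfolding closure_approachable dist_norm by blast
  \<comment> \<open>Now \<open>\<gamma> w = k\<close>, while \<open>v\<close> and \<open>u\<close>
    solve the first two components exactly for \<open>g\<close> and \<open>f'\<close>. The error in
    \<tau> times the third component is the one made by \<open>k\<close>, hence the factor \<tau> in
    its bound.\<close>
  define w where "w = inverse \<gamma> *\<^sub>R k"
  define v where "v = inverse l0 *\<^sub>R (w + g)"
  define u where "u = inverse l0 *\<^sub>R (v + f')"
  have "l0 \<noteq> 0" using b_pos params by simp
  then have u: "l0 *\<^sub>R u = v + f'" and v: "l0 *\<^sub>R v = w + g"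
    by (simp_all add: u_def v_def)
  have f'V: "f' \<in> V \<times> V" using f'(1) DD_VV by blast
  have w: "w \<in> V \<times> V" unfolding w_def using k(1) by (intro VV_closed)
  then have vV: "v \<in> V \<times> V" unfolding v_def using fg by (intro VV_closed)
  then have uV: "u \<in> V \<times> V" unfolding u_def using f'V by (intro VV_closed)
  have "c\<^sup>2 = - b * l0" using b_pos by simp
  then have "c\<^sup>2 *\<^sub>R u = - b *\<^sub>R (l0 *\<^sub>R u)" by simp
  then have p: "c\<^sup>2 *\<^sub>R u + b *\<^sub>R v = - b *\<^sub>R f'"
    unfolding u by (simp add: algebra_simps)
  have "pack u v w \<in> dom_T \<times> dom_T"
    unfolding pack_mem_mgt_domain p using uV vV w f'(1) subspace_scale [OF subspace_DD] by blast
  moreover have "N (shifted T (of_real l0) (pack u v w) - y) < e"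
  proof -
    define h' where "h' = l0 *\<^sub>R w + inverse \<tau> *\<^sub>R \<AA> (- b *\<^sub>R f') + (inverse \<tau> * \<alpha>) *\<^sub>R w"
    have "\<tau> *\<^sub>R (h' - h) = (\<tau> * l0 + \<alpha>) *\<^sub>R w - b *\<^sub>R \<AA> f' - \<tau> *\<^sub>R h"
      using params unfolding h'_def linear_operator_scaleR [OF linear_AA f'(1)]
      by (simp add: algebra_simps)
    also have "(\<tau> * l0 + \<alpha>) *\<^sub>R w = k"
      using \<gamma> unfolding gamma_eq by (simp add: w_def \<gamma>_def)
    finally have "\<tau> *\<^sub>R (h' - h) = k - (\<tau> *\<^sub>R h + b *\<^sub>R \<AA> f')" by simp
    then have "norm (\<tau> *\<^sub>R (h' - h)) < \<tau> * (e / 2)" using k(2) by simp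
    then have h': "norm (h' - h) < e / 2" using params by simp
    have "shifted T (of_real l0) (pack u v w) - y = pack (f' - f) 0 (h' - h)"
      unfolding shifted_mgt_op_pack p fgh pack_diff pack_eq_iff cscale_of_real h'_def u v by simp
    then have "N (shifted T (of_real l0) (pack u v w) - y)
        \<le> norm (\<BB> (f' - f)) + norm (\<BB> 0) + norm (h' - h)"
      by (metis cnorm_H0_norm_pack_le)
    also have "\<dots> < e"
      using f'(2) h' linear_operator_diff [OF linear_BB f'V fg(1)] linear_operator_zero [OF linear_BB]
      by simp
    finally show ?thesis .
  qed
  ultimately show "\<exists>z\<in>dom_T \<times> dom_T. N (shifted T (of_real l0) z - y) < e"
    by (rule bexI [rotated])
qed

text \<open>On an eigenvector for \<open>x n\<close>, the operator \<open>l - T\<close> acts as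
  multiplication by \<open>l - x n\<close>. These factors tend to 0, which contradicts a lower bound
  for \<open>l - T\<close>.\<close>

lemma limit_of_eigenvalues_not_in_resolvent_set:
  assumes "\<And>n. x n \<in> point_spectrum dom_T T" "x \<longlonglongrightarrow> l"
  shows "l \<notin> resolvent_set (H0_space V) (H0_norm B) dom_T T"
proof
  assume "l \<in> resolvent_set (H0_space V) (H0_norm B) dom_T T"
  then obtain C where C: "\<And>z. z \<in> dom_T \<times> dom_T \<Longrightarrow> N z \<le> C * N (shifted T l z)"
    unfolding resolvent_set_def by blast
  have "1 \<le> C * cmod (l - x n)" for n
  proof -
    obtain z where z: "z \<in> dom_T \<times> dom_T" "z \<noteq> 0" "map_prod T T z = cscale (x n) z"
      using assms(1) [of n] unfolding point_spectrum_def by blast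
    have "shifted T l z = cscale (l - x n) z"
      by (simp add: shifted_def z(3) cscale.scale_left_diff_distrib)
    then have "N z \<le> (C * cmod (l - x n)) * N z"
      using C [OF z(1)] N_cscale [OF z(1)] by simp
    then show ?thesis
      using N_pos [OF z(1,2)] by simp
  qed
  moreover have "(\<lambda>n. C * cmod (l - x n)) \<longlonglongrightarrow> C * cmod (l - l)"
    by (intro tendsto_intros assms)
  ultimately have "1 \<le> C * cmod (l - l)"
    by (intro LIMSEQ_le_const) auto
  then show False by simp
qed

section \<open>Residual and continuous spectrum\<close>

lemma mgt_spectrum_cases:
  assumes "l \<in> spectrum (H0_space V) (H0_norm B) dom_T T" "l \<notin> point_spectrum dom_T T"
  shows "l = of_real l0" "gamma_coeff \<alpha> c \<delta> \<tau> \<noteq> 0"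
proof -
  have cubic: "mgt_cubic \<alpha> c \<delta> \<tau> (\<mu> n) l \<noteq> 0" for n
    using assms(2) unfolding mgt_point_spectrum by blast
  \<comment> \<open>If \<open>q l\<close> were nonzero, \<open>l\<close> would be in the resolvent
    set. At the zero of \<open>q\<close>, a vanishing \<gamma> would make \<open>l\<close> an
    eigenvalue.\<close>
  then have "q l = 0"
    using mgt_resolvent_set [of l] assms(1) unfolding spectrum_def by blast
  then show l: "l = of_real l0"
    by (simp only: q_zero_iff)
  show "gamma_coeff \<alpha> c \<delta> \<tau> \<noteq> 0"
    using cubic unfolding l cubic_at_limit by auto
qed

lemma mgt_residual_spectrum: "residual_spectrum (H0_space V) (H0_norm B) dom_T T = {}"
  unfolding residual_spectrum_def using mgt_spectrum_cases mgt_dense_range by blast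

lemma mgt_continuous_spectrum_empty:
  assumes "gamma_coeff \<alpha> c \<delta> \<tau> = 0"
  shows "continuous_spectrum (H0_space V) (H0_norm B) dom_T T = {}"
  unfolding continuous_spectrum_def using mgt_spectrum_cases(2) assms by blast

text \<open>The sequence \<open>x\<close> stands for the real branch of eigenvalues. It keeps
  \<open>l0\<close> in the spectrum, and \<gamma> being nonzero keeps \<open>l0\<close> out of the
  point spectrum.\<close>

lemma mgt_continuous_spectrum:
  assumes \<gamma>: "gamma_coeff \<alpha> c \<delta> \<tau> \<noteq> 0"
    and x: "\<And>n. of_real (x n) \<in> point_spectrum dom_T T" "x \<longlonglongrightarrow> l0"
  shows "continuous_spectrum (H0_space V) (H0_norm B) dom_T T = {of_real l0}"
proof -
  have "(\<lambda>n. of_real (x n)) \<longlonglongrightarrow> (of_real l0 :: complex)"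
    by (rule tendsto_of_real [OF x(2)])
  from limit_of_eigenvalues_not_in_resolvent_set [OF x(1) this]
  have "of_real l0 \<in> spectrum (H0_space V) (H0_norm B) dom_T T"
    unfolding spectrum_def by simp
  moreover have "l0 \<noteq> 0"
    using b_pos params by simp
  with \<gamma> have "of_real l0 \<notin> point_spectrum dom_T T"
    unfolding mgt_point_spectrum mem_Collect_eq cubic_at_limit by simp
  ultimately show ?thesis
    unfolding continuous_spectrum_def using mgt_spectrum_cases(1) mgt_dense_range [OF \<gamma>] by blast
qed

end

subsection \<open>Roots of the cubic\<close>

text \<open>The cubic changes sign between the two infinities. The points \<open>u\<close> and
  \<open>v\<close> come in no particular order, so the intermediate value theorem is used in both
  directions.\<close>

lemma odd_cubic_real_root:
  fixes t a p q :: real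
  assumes "t > 0"
  obtains x where "t * x ^ 3 + a * x\<^sup>2 + p * x + q = 0"
proof -
  let ?f = "\<lambda>x. t * x ^ 3 + a * x\<^sup>2 + p * x + q"
  have top: "filterlim ?f at_top at_top" and bot: "filterlim ?f at_bot at_bot"
    using assms by real_asymp+
  obtain u where u: "?f u \<ge> 0"
    using top by (metis (no_types, lifting) eventually_at_top_linorder filterlim_at_top order_refl)
  obtain v where v: "?f v \<le> 0"
    using bot by (metis (no_types, lifting) eventually_at_bot_linorder filterlim_at_bot order_refl)
  have cont: "continuous_on S ?f" for S
    by (intro continuous_intros)
  show ?thesis
  proof (cases "u \<le> v")
    case True
    then show ?thesis
      using IVT2' [OF v u True cont] that by blast
  next
    case False
    then show ?thesis
      using IVT' [of ?f v 0 u] v u cont that by force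
  qed
qed

text \<open>Division by \<open>z - x\<close> leaves \<tau> times a quadratic
  \<open>z^2 + p z + q\<close>; the premise of the last clause says that its discriminant is
  negative.\<close>

lemma mgt_cubic_roots:
  assumes "\<tau> > 0"
  obtains x :: real and l1 l2 :: complex where
    "\<tau> * x ^ 3 + \<alpha> * x\<^sup>2 + b_coeff c \<delta> \<tau> * m * x + c\<^sup>2 * m = 0"
    "\<And>z. mgt_cubic \<alpha> c \<delta> \<tau> m z = of_real \<tau> * (z - of_real x) * (z - l1) * (z - l2)"
    "(\<alpha> / \<tau> + x)\<^sup>2 < 4 * (b_coeff c \<delta> \<tau> * m / \<tau> + x * (\<alpha> / \<tau> + x)) \<Longrightarrow>
      Re l1 = - (\<alpha> / \<tau> + x) / 2 \<and> l2 = cnj l1 \<and>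
      Im l1 = sqrt (4 * (b_coeff c \<delta> \<tau> * m / \<tau> + x * (\<alpha> / \<tau> + x)) - (\<alpha> / \<tau> + x)\<^sup>2) / 2"
proof -
  obtain x where x: "\<tau> * x ^ 3 + \<alpha> * x\<^sup>2 + (b_coeff c \<delta> \<tau> * m) * x + c\<^sup>2 * m = 0"
    using odd_cubic_real_root [OF assms] by blast
  define p where "p = \<alpha> / \<tau> + x"
  define q where "q = b_coeff c \<delta> \<tau> * m / \<tau> + x * p"
  define r where "r = csqrt (of_real (p\<^sup>2 - 4 * q))"
  define l1 where "l1 = (- of_real p + r) / 2"
  define l2 where "l2 = (- of_real p - r) / 2"
  have c: "\<alpha> = \<tau> * (p - x)" "b_coeff c \<delta> \<tau> * m = \<tau> * (q - x * p)"
    using assms by (simp_all add: p_def q_def)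
  have c': "c\<^sup>2 * m = - (\<tau> * x * q)"
    using x unfolding c by (simp add: algebra_simps power2_eq_square power3_eq_cube)
  have "l1 + l2 = - of_real p"
    by (simp add: l1_def l2_def field_simps)
  moreover have "l1 * l2 = of_real q"
  proof -
    have "r\<^sup>2 = of_real (p\<^sup>2 - 4 * q)"
      by (simp add: r_def)
    then show ?thesis
      by (simp add: l1_def l2_def field_simps power2_eq_square)
  qed
  moreover have "(z - l1) * (z - l2) = z\<^sup>2 - (l1 + l2) * z + l1 * l2" for z
    by (simp add: algebra_simps power2_eq_square)
  ultimately have quad: "(z - l1) * (z - l2) = z\<^sup>2 + of_real p * z + of_real q" for z
    by simp
  have "mgt_cubic \<alpha> c \<delta> \<tau> m z = of_real \<tau> * (z - of_real x) * (z - l1) * (z - l2)" for z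
    unfolding mgt_cubic_def mult.assoc quad unfolding c c'
    by (simp add: algebra_simps power2_eq_square power3_eq_cube)
  moreover have "Re l1 = - p / 2 \<and> l2 = cnj l1 \<and> Im l1 = sqrt (4 * q - p\<^sup>2) / 2" if "p\<^sup>2 < 4 * q"
  proof -
    \<comment> \<open>The principal square root fixes the labelling: \<open>l1\<close> is the root
      with positive imaginary part.\<close>
    have "r = \<i> * of_real (sqrt (4 * q - p\<^sup>2))"
      using that csqrt_of_real_nonpos [of "of_real (p\<^sup>2 - 4 * q)"] by (simp add: r_def)
    then show ?thesis
      by (simp add: l1_def l2_def complex_eq_iff)
  qed
  ultimately show ?thesis
    using that x unfolding q_def p_def by blast
qed

text \<open>
  A real root \<open>x\<close> satisfies \<open>m (b x + c\<^sup>2) = - x\<^sup>2 (\<tau> x + \<alpha>)\<close>, so it lies between 0 and the smaller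
  of \<open>- \<alpha>/\<tau>\<close> and \<open>- c\<^sup>2/b\<close> and its distance to \<open>- c\<^sup>2/b\<close> is at most of order \<open>1/m\<close>.
\<close>

lemma mgt_cubic_real_root_bound:
  fixes x m \<alpha> c b \<tau> :: real
  assumes "\<tau> * x ^ 3 + \<alpha> * x\<^sup>2 + b * m * x + c\<^sup>2 * m = 0"
    and "\<alpha> > 0" "c > 0" "b > 0" "\<tau> > 0" "m > 0"
  defines "K \<equiv> max (\<alpha> / \<tau>) (c\<^sup>2 / b)"
  shows "\<bar>x - (- c\<^sup>2 / b)\<bar> \<le> K\<^sup>2 * (\<tau> * K + \<alpha>) / b / m"
proof -
  have eq: "m * (b * x + c\<^sup>2) = - (x\<^sup>2 * (\<tau> * x + \<alpha>))"
    using assms(1) by (simp add: algebra_simps power2_eq_square power3_eq_cube)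
  have K: "K > 0" "\<alpha> \<le> \<tau> * K" "c\<^sup>2 \<le> b * K"
    using assms by (auto simp: K_def less_max_iff_disj field_simps max_def)
  have "x \<le> 0"
  proof (rule ccontr)
    assume "\<not> x \<le> 0"
    then have "m * (b * x + c\<^sup>2) > 0" "x\<^sup>2 * (\<tau> * x + \<alpha>) > 0"
      using assms by (auto intro!: mult_pos_pos add_pos_pos)
    with eq show False by linarith
  qed
  moreover have "x \<ge> - K"
  proof (rule ccontr)
    assume *: "\<not> x \<ge> - K"
    \<comment> \<open>Left of \<open>- K\<close> both linear factors are negative, so the left side
      of \<open>eq\<close> is negative and the right side is not.\<close>
    have "\<tau> * x < \<tau> * (- K)" "b * x < b * (- K)"
      using mult_strict_left_mono [of x "- K"] * assms(4,5) by (simp_all add: not_le)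
    then have "\<tau> * x + \<alpha> < 0" "b * x + c\<^sup>2 < 0"
      using K by auto
    then have "m * (b * x + c\<^sup>2) < 0" "x\<^sup>2 * (\<tau> * x + \<alpha>) \<le> 0"
      using assms by (auto intro!: mult_pos_neg mult_nonneg_nonpos)
    with eq show False by linarith
  qed
  ultimately have x: "\<bar>x\<bar> \<le> K" by simp
  have "x - (- c\<^sup>2 / b) = (b * x + c\<^sup>2) / b"
    using assms(4) by (simp add: field_simps)
  then have "m * b * \<bar>x - (- c\<^sup>2 / b)\<bar> = \<bar>m * (b * x + c\<^sup>2)\<bar>"
    using assms(4,6) by (simp add: abs_mult)
  also have "\<dots> = \<bar>x\<bar>\<^sup>2 * \<bar>\<tau> * x + \<alpha>\<bar>"
    by (simp add: eq abs_mult)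
  also have "\<dots> \<le> K\<^sup>2 * (\<tau> * K + \<alpha>)"
  proof (intro mult_mono power_mono)
    have "\<bar>\<tau> * x + \<alpha>\<bar> \<le> \<tau> * \<bar>x\<bar> + \<alpha>"
      using assms abs_triangle_ineq [of "\<tau> * x" \<alpha>] by (simp add: abs_mult)
    also have "\<dots> \<le> \<tau> * K + \<alpha>"
      using x assms by simp
    finally show "\<bar>\<tau> * x + \<alpha>\<bar> \<le> \<tau> * K + \<alpha>" .
  qed (use x K in auto)
  finally show ?thesis
    using assms by (simp add: field_simps)
qed

text \<open>The real root converges by the bound of order \<open>1 / \<mu> n\<close>. The sum of the
  roots then gives the limit of the real parts, and the growth of the negated discriminant makes the
  other two roots non-real with unbounded imaginary parts.\<close>

lemma mgt_cubic_root_asymptotics: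
  fixes \<mu> :: "nat \<Rightarrow> real"
  assumes \<mu>: "filterlim \<mu> at_top sequentially"
    and pos: "\<alpha> > 0" "c > 0" "\<delta> > 0" "\<tau> > 0"
  obtains x :: "nat \<Rightarrow> real" and l1 l2 :: "nat \<Rightarrow> complex" where
    "\<And>n z. mgt_cubic \<alpha> c \<delta> \<tau> (\<mu> n) z = of_real \<tau> * (z - of_real (x n)) * (z - l1 n) * (z - l2 n)"
    "x \<longlonglongrightarrow> - c\<^sup>2 / b_coeff c \<delta> \<tau>"
    "\<forall>\<^sub>F n in sequentially. l1 n \<notin> \<real> \<and> l2 n \<notin> \<real> \<and> l2 n = cnj (l1 n)"
    "(\<lambda>n. Re (l1 n)) \<longlonglongrightarrow> - gamma_coeff \<alpha> c \<delta> \<tau> / (2 * \<tau>)"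
    "filterlim (\<lambda>n. \<bar>Im (l1 n)\<bar>) at_top sequentially"
proof -
  define b where "b = b_coeff c \<delta> \<tau>"
  have b: "b > 0" using pos by (simp add: b_def b_coeff_def add_pos_nonneg)
  \<comment> \<open>For a real root \<open>y\<close>, \<open>P y\<close> is the linear coefficient
    of the quadratic factor and \<open>Q m y\<close> is minus its discriminant.\<close>
  define P where "P y = \<alpha> / \<tau> + y" for y
  define Q where "Q m y = 4 * (b * m / \<tau> + y * P y) - (P y)\<^sup>2" for m y
  have "\<exists>x l1 l2. \<tau> * x ^ 3 + \<alpha> * x\<^sup>2 + b * \<mu> n * x + c\<^sup>2 * \<mu> n = 0 \<and>
      (\<forall>z. mgt_cubic \<alpha> c \<delta> \<tau> (\<mu> n) z = of_real \<tau> * (z - of_real x) * (z - l1) * (z - l2)) \<and>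
      (Q (\<mu> n) x > 0 \<longrightarrow> Re l1 = - P x / 2 \<and> l2 = cnj l1 \<and> Im l1 = sqrt (Q (\<mu> n) x) / 2)" for n
    using mgt_cubic_roots [OF pos(4), of \<alpha> c \<delta> "\<mu> n"]
    unfolding b_def P_def Q_def diff_gt_0_iff_gt by metis
  then obtain x l1 l2 where
    x: "\<And>n. \<tau> * x n ^ 3 + \<alpha> * (x n)\<^sup>2 + b * \<mu> n * x n + c\<^sup>2 * \<mu> n = 0" and
    fac: "\<And>n z. mgt_cubic \<alpha> c \<delta> \<tau> (\<mu> n) z
      = of_real \<tau> * (z - of_real (x n)) * (z - l1 n) * (z - l2 n)" and
    l: "\<And>n. Q (\<mu> n) (x n) > 0 \<Longrightarrow>
      Re (l1 n) = - P (x n) / 2 \<and> l2 n = cnj (l1 n) \<and> Im (l1 n) = sqrt (Q (\<mu> n) (x n)) / 2"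
    by metis
  define C where "C = (max (\<alpha> / \<tau>) (c\<^sup>2 / b))\<^sup>2 * (\<tau> * max (\<alpha> / \<tau>) (c\<^sup>2 / b) + \<alpha>) / b"
  have lim: "x \<longlonglongrightarrow> - c\<^sup>2 / b"
  proof (rule Lim_transform_bound [where g = "\<lambda>n. C / \<mu> n", THEN LIM_zero_cancel])
    show "\<forall>\<^sub>F n in sequentially. norm (x n - - c\<^sup>2 / b) \<le> norm (C / \<mu> n)"
      using filterlim_at_top_dense [THEN iffD1, OF \<mu>, rule_format, of 0]
    proof eventually_elim
      case (elim n)
      then have "\<bar>x n - (- c\<^sup>2 / b)\<bar> \<le> C / \<mu> n"
        using mgt_cubic_real_root_bound [OF x pos(1,2) b pos(4), of n] by (simp add: C_def)
      then show ?case
        unfolding real_norm_def by linarith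
    qed
    show "(\<lambda>n. C / \<mu> n) \<longlonglongrightarrow> 0"
      by (intro real_tendsto_divide_at_top [OF tendsto_const \<mu>])
  qed
  \<comment> \<open>\<open>Q\<close> is split into a convergent sequence and a positive multiple of
    \<open>\<mu> n\<close>.\<close>
  have "filterlim (\<lambda>n. (4 * (x n * P (x n)) - (P (x n))\<^sup>2) + (4 * b / \<tau>) * \<mu> n) at_top sequentially"
  proof (rule filterlim_tendsto_add_at_top)
    show "(\<lambda>n. 4 * (x n * P (x n)) - (P (x n))\<^sup>2) \<longlonglongrightarrow>
        4 * ((- c\<^sup>2 / b) * P (- c\<^sup>2 / b)) - (P (- c\<^sup>2 / b))\<^sup>2"
      unfolding P_def by (intro tendsto_intros lim)
    show "filterlim (\<lambda>n. (4 * b / \<tau>) * \<mu> n) at_top sequentially"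
      using b pos by (intro filterlim_tendsto_pos_mult_at_top [OF tendsto_const _ \<mu>]) auto
  qed
  then have Q: "filterlim (\<lambda>n. Q (\<mu> n) (x n)) at_top sequentially"
    by (simp add: Q_def algebra_simps)
  then have Qpos: "\<forall>\<^sub>F n in sequentially. Q (\<mu> n) (x n) > 0"
    by (simp add: filterlim_at_top_dense)
  show ?thesis
  proof (rule that [OF fac lim [unfolded b_def]])
    show "\<forall>\<^sub>F n in sequentially. l1 n \<notin> \<real> \<and> l2 n \<notin> \<real> \<and> l2 n = cnj (l1 n)"
      using Qpos
    proof eventually_elim
      case (elim n)
      then have "Im (l1 n) = sqrt (Q (\<mu> n) (x n)) / 2" using l by blast
      with elim have "Im (l1 n) > 0" by (simp del: divide_eq_eq_numeral1 eq_divide_eq_numeral1)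
      with l [OF elim] show ?case by (simp add: complex_is_Real_iff)
    qed
    have "(\<lambda>n. - P (x n) / 2) \<longlonglongrightarrow> - P (- c\<^sup>2 / b) / 2"
      unfolding P_def by (intro tendsto_intros lim) auto
    \<comment> \<open>This is
      \<open>\<alpha> / \<tau> - c^2 / b = \<gamma> / \<tau>\<close>.\<close>
    also have "- P (- c\<^sup>2 / b) / 2 = - gamma_coeff \<alpha> c \<delta> \<tau> / (2 * \<tau>)"
      using pos b by (simp add: P_def gamma_coeff_def field_simps flip: b_def)
    finally show "(\<lambda>n. Re (l1 n)) \<longlonglongrightarrow> - gamma_coeff \<alpha> c \<delta> \<tau> / (2 * \<tau>)"
    proof (rule Lim_transform_eventually)
      show "\<forall>\<^sub>F n in sequentially. - P (x n) / 2 = Re (l1 n)"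
        using Qpos by eventually_elim (use l in auto)
    qed
    have "filterlim (\<lambda>n. (1/2) * sqrt (Q (\<mu> n) (x n))) at_top sequentially"
      by (intro filterlim_tendsto_pos_mult_at_top [OF tendsto_const]
          filterlim_compose [OF sqrt_at_top Q]) auto
    moreover have "\<forall>\<^sub>F n in sequentially. (1/2) * sqrt (Q (\<mu> n) (x n)) = \<bar>Im (l1 n)\<bar>"
      using Qpos
    proof eventually_elim
      case (elim n)
      then have Im: "Im (l1 n) = sqrt (Q (\<mu> n) (x n)) / 2" using l by blast
      show ?case unfolding Im using elim by simp
    qed
    ultimately show "filterlim (\<lambda>n. \<bar>Im (l1 n)\<bar>) at_top sequentially"
      by (rule filterlim_mono_eventually [OF _ order_refl order_refl])
  qed
qed

subsection \<open>The spectrum\<close>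

theorem proposition2p4:
  fixes A B :: "'a::{real_inner, complete_space} \<Rightarrow> 'a"
    and D V :: "'a set"
    and \<mu> :: "nat \<Rightarrow> real"
    and \<alpha> c \<delta> \<tau> :: real
  assumes "separable_space (euclidean :: 'a topology)"
    and "\<not> (\<exists>S :: 'a set. finite S \<and> span S = UNIV)"
    and "self_adjoint D A"
    and "\<forall>x\<in>D. x \<noteq> 0 \<longrightarrow> 0 < inner (A x) x"
    and "compact_resolvent D A"
    and "is_sqrt_of V B D A"
    and "point_spectrum D A = range (\<lambda>n. of_real (\<mu> n))"
    and "filterlim \<mu> at_top sequentially"
    and "\<alpha> > 0" and "c > 0" and "\<delta> > 0" and "\<tau> > 0"
  shows
    "residual_spectrum (H0_space V) (H0_norm B) (mgt_domain D V c \<delta> \<tau>) (mgt_op A \<alpha> c \<delta> \<tau>) = {}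
     \<and> (gamma_coeff \<alpha> c \<delta> \<tau> > 0 \<longrightarrow>
         continuous_spectrum (H0_space V) (H0_norm B) (mgt_domain D V c \<delta> \<tau>) (mgt_op A \<alpha> c \<delta> \<tau>)
           = {of_real (- c\<^sup>2 / b_coeff c \<delta> \<tau>)})
     \<and> (gamma_coeff \<alpha> c \<delta> \<tau> = 0 \<longrightarrow>
         continuous_spectrum (H0_space V) (H0_norm B) (mgt_domain D V c \<delta> \<tau>) (mgt_op A \<alpha> c \<delta> \<tau>)
           = {})
     \<and> point_spectrum (mgt_domain D V c \<delta> \<tau>) (mgt_op A \<alpha> c \<delta> \<tau>)
         = {l. \<exists>n. mgt_cubic \<alpha> c \<delta> \<tau> (\<mu> n) l = 0}
     \<and> (\<exists>l0 l1 l2 :: nat \<Rightarrow> complex.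
          (\<forall>n z. mgt_cubic \<alpha> c \<delta> \<tau> (\<mu> n) z = of_real \<tau> * (z - l0 n) * (z - l1 n) * (z - l2 n))
          \<and> point_spectrum (mgt_domain D V c \<delta> \<tau>) (mgt_op A \<alpha> c \<delta> \<tau>)
              = range l0 \<union> range l1 \<union> range l2
          \<and> (\<forall>\<^sub>F n in sequentially. l0 n \<in> \<real>)
          \<and> (\<forall>\<^sub>F n in sequentially. l1 n \<notin> \<real> \<and> l2 n \<notin> \<real> \<and> l2 n = cnj (l1 n))
          \<and> l0 \<longlonglongrightarrow> of_real (- c\<^sup>2 / b_coeff c \<delta> \<tau>)
          \<and> (\<lambda>n. Re (l1 n)) \<longlonglongrightarrow> - gamma_coeff \<alpha> c \<delta> \<tau> / (2 * \<tau>)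
          \<and> filterlim (\<lambda>n. \<bar>Im (l1 n)\<bar>) at_top sequentially)"
proof -
  interpret mgt A B D V \<mu> \<alpha> c \<delta> \<tau>
    using assms by unfold_locales auto
  obtain x l1 l2 where
    fac: "\<And>n z. mgt_cubic \<alpha> c \<delta> \<tau> (\<mu> n) z
      = of_real \<tau> * (z - of_real (x n)) * (z - l1 n) * (z - l2 n)"
    and x: "x \<longlonglongrightarrow> - c\<^sup>2 / b_coeff c \<delta> \<tau>"
    and nonreal: "\<forall>\<^sub>F n in sequentially. l1 n \<notin> \<real> \<and> l2 n \<notin> \<real> \<and> l2 n = cnj (l1 n)"
    and Re: "(\<lambda>n. Re (l1 n)) \<longlonglongrightarrow> - gamma_coeff \<alpha> c \<delta> \<tau> / (2 * \<tau>)"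
    and Im: "filterlim (\<lambda>n. \<bar>Im (l1 n)\<bar>) at_top sequentially"
    using mgt_cubic_root_asymptotics [OF assms(8-12)] by blast
  have "mgt_cubic \<alpha> c \<delta> \<tau> (\<mu> n) z = 0 \<longleftrightarrow> z = of_real (x n) \<or> z = l1 n \<or> z = l2 n" for n z
    using params(4) by (simp add: fac)
  then have ps: "point_spectrum dom_T T = range (\<lambda>n. of_real (x n)) \<union> range l1 \<union> range l2"
    unfolding mgt_point_spectrum by auto
  then have "of_real (x n) \<in> point_spectrum dom_T T" for n by blast
  \<comment> \<open>The real branch is the sequence of eigenvalues that tends to the exceptional
    point.\<close>
  note continuous = mgt_continuous_spectrum [OF _ this x]
  have "\<exists>l0 l1 l2 :: nat \<Rightarrow> complex.
      (\<forall>n z. mgt_cubic \<alpha> c \<delta> \<tau> (\<mu> n) z = of_real \<tau> * (z - l0 n) * (z - l1 n) * (z - l2 n))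
      \<and> point_spectrum (mgt_domain D V c \<delta> \<tau>) (mgt_op A \<alpha> c \<delta> \<tau>)
          = range l0 \<union> range l1 \<union> range l2
      \<and> (\<forall>\<^sub>F n in sequentially. l0 n \<in> \<real>)
      \<and> (\<forall>\<^sub>F n in sequentially. l1 n \<notin> \<real> \<and> l2 n \<notin> \<real> \<and> l2 n = cnj (l1 n))
      \<and> l0 \<longlonglongrightarrow> of_real (- c\<^sup>2 / b_coeff c \<delta> \<tau>)
      \<and> (\<lambda>n. Re (l1 n)) \<longlonglongrightarrow> - gamma_coeff \<alpha> c \<delta> \<tau> / (2 * \<tau>)
      \<and> filterlim (\<lambda>n. \<bar>Im (l1 n)\<bar>) at_top sequentially"
    by (rule exI [where x = "\<lambda>n. of_real (x n)"], rule exI [where x = l1], rule exI [where x = l2],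
        intro conjI allI fac ps nonreal Re Im tendsto_of_real [OF x] always_eventually Reals_of_real)
  then show ?thesis
    using continuous mgt_residual_spectrum mgt_continuous_spectrum_empty mgt_point_spectrum
    by (intro conjI impI) simp_all
qed

end
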